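(* We have $$\lim_{n\to\infty}\max\{p(T_5^8;T_n) : T_n \text{ a tournament with } |T_n|=n\}=\frac{15}{128}.$$ Furthermore, if $(T_n)_{n\in\mathbb{N}}$ is a sequence of tournaments of increasing sizes, then $\lim_{n\to\infty}p(T_5^8;T_n)=15/128$ if and only if $(T_n)_{n\in\mathbb{N}}$ is quasi-random, i.e., if and only if for every fixed finite tournament $T$ $$\lim_{n\to\infty}p(T;T_n)=\phi_{\mathrm{qr}}(T):=\frac{|T|!}{|\mathrm{Aut}(T)|\,2^{\binom{|T|}{2}}}.$$
   Context: A tournament is a finite directed graph without loops having exactly one arc between each pair of distinct vertices; $|T|=|V(T)|$ is its size and $\mathrm{Aut}(T)$ its automorphism group. For tournaments $T,T'$ with $|T|\le|T'|$, $p(T;T')\in[0,1]$ is the (unlabelled, induced) density of $T$ in $T'$: the probability that a uniformly random $|T|$-element subset of $V(T')$ induces a subtournament isomorphic to $T$. A sequence $(T_n)$ has increasing sizes if $|T_n|<|T_{n+1}|$ for all $n$. $T_5^8$ is the tournament on vertices $1,\dots,5$ with arcs $1\to2,\ 1\to3,\ 1\to4,\ 2\to3,\ 2\to4,\ 2\to5,\ 3\to4,\ 4\to5,\ 5\to1,\ 5\to3$. The quasi-random homomorphism $\phi_{\mathrm{qr}}$ is the almost sure limit of the uniformly random tournaments on $n$ vertices (each arc oriented independently with probability $1/2$), given by the formula in the statement. *)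

theory Defs
  imports
    Complex_Main
    "Graph_Theory.Pair_Digraph"
    "Graph_Theory.Digraph_Isomorphism"
    "HOL-Combinatorics.Permutations"
begin

locale tournament = pair_digraph +
  assumes exactly_one_arc:
    "u \<in> pverts G \<Longrightarrow> v \<in> pverts G \<Longrightarrow> u \<noteq> v \<Longrightarrow> ((u, v) \<in> parcs G) \<noteq> ((v, u) \<in> parcs G)"

text \<open>An automorphism is represented by the permutation of the whole type that fixes every
  non-vertex, so that the cardinality of this set is the order of the automorphism group.\<close>

definition Aut :: "'a pair_pre_digraph \<Rightarrow> ('a \<Rightarrow> 'a) set" where
  "Aut T = {f. f permutes pverts T \<and>
     (\<forall>u\<in>pverts T. \<forall>v\<in>pverts T. (f u, f v) \<in> parcs T \<longleftrightarrow> (u, v) \<in> parcs T)}"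

text \<open>The density is only meaningful if the second tournament has at least as many vertices as
  the first one; otherwise it takes the value 0.\<close>

definition density :: "'a pair_pre_digraph \<Rightarrow> 'b pair_pre_digraph \<Rightarrow> real" where
  "density T T' =
     real (card {S. S \<subseteq> pverts T' \<and> card S = card (pverts T) \<and>
                    digraph_iso (with_proj T' \<restriction> S) (with_proj T)}) /
     real (card (pverts T') choose card (pverts T))"

definition T58 :: "nat pair_pre_digraph" where
  "T58 = \<lparr>pverts = {1..5},
          parcs = {(1,2), (1,3), (1,4), (2,3), (2,4), (2,5), (3,4), (4,5), (5,1), (5,3)}\<rparr>"

definition phi_qr :: "'a pair_pre_digraph \<Rightarrow> real" where
  "phi_qr T = fact (card (pverts T)) / (real (card (Aut T)) * 2 ^ (card (pverts T) choose 2))"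

text \<open>Every finite tournament is isomorphic to one with vertices in \<^typ>\<open>nat\<close>, so it suffices to
  let the test tournaments range over that type.\<close>

definition quasi_random :: "(nat \<Rightarrow> 'a pair_pre_digraph) \<Rightarrow> bool" where
  "quasi_random Ts \<longleftrightarrow>
     (\<forall>T :: nat pair_pre_digraph. tournament T \<longrightarrow> (\<lambda>n. density T (Ts n)) \<longlonglongrightarrow> phi_qr T)"

end

theory Submission
  imports Defs "HOL-Analysis.Convex"
begin

text \<open>Let \<open>A\<close> be the skew matrix of a tournament on \<open>n\<close> vertices, with entries \<open>1\<close>, \<open>-1\<close> and zero diagonal.
  Up to \<open>2^10\<close>, the number of labelled copies of \<open>T58\<close> is at most the sum over all 5-tuples of the product
  of \<open>1 + A\<close> over the ten arcs. Expanding gives \<open>n^5\<close> plus signed sums over subgraphs; most of them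
  cancel or vanish, because reversing an arc changes the sign. Each remaining subgraph has two nonadjacent
  vertices, and summing these out turns the remainder into a sum over vertex triples of a quadratic
  form in the degrees, codegrees and joint degrees of the triple. The symmetrized form is negative
  definite, both for transitive and for cyclic triples, and even dominates the sum of the squared codegrees,
  which is the signed number of 4-cycles. So the density is asymptotically at most \<open>15/128\<close>, and if it
  attains this limit, then the signed number of 4-cycles is of lower order, which makes the signed sums of all
  nonempty patterns negligible by Cauchy-Schwarz. The bound is attained on average over all tournaments.\<close>

section \<open>Signed sums over patterns on five vertices\<close>

text \<open>A nonadjacent pair always exists because exchanging two vertices of the complete pattern
  reverses just the arc between them, so its sum is its own negative. The summands of the other
  surviving sums have no fixed sign, so these sums are bounded together. The freedom for this is
  that a pattern with several nonadjacent pairs can be written as a sum over triples in several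
  ways, and its coefficient may be split among them at will. Tuples with repetitions contribute
  nonnegative products and may therefore be included in an upper bound without any error term.
  Triples with repeated vertices, where entries of \<open>A\<close> vanish, are covered because the
  form is affine in each arc, so that bounds at the signs extend to all of [-1,1]. The expansion
  itself is left to evaluation, by a matcher that is proved sound.\<close>

type_synonym arc_list = "(nat \<times> nat) list"

text \<open>Patterns are graphs on the vertices 1 to 5, each edge carrying a reference orientation. The value is
  \<open>1\<close> or \<open>-1\<close> if \<^term>\<open>p\<close> maps the pattern \<^term>\<open>H\<close> onto \<^term>\<open>R\<close> up to an even or odd number of reversals,
  and \<open>0\<close> otherwise.\<close>

primrec match_arcs :: "(nat \<Rightarrow> nat) \<Rightarrow> arc_list \<Rightarrow> arc_list \<Rightarrow> int" where
  "match_arcs p [] R = (if R = [] then 1 else 0)"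
| "match_arcs p (e # H) R =
     (if (p (fst e), p (snd e)) \<in> set R then match_arcs p H (remove1 (p (fst e), p (snd e)) R)
      else if (p (snd e), p (fst e)) \<in> set R then - match_arcs p H (remove1 (p (snd e), p (fst e)) R)
      else 0)"

definition arc_degree :: "arc_list \<Rightarrow> nat \<Rightarrow> nat" where
  "arc_degree H v = length (filter (\<lambda>e. fst e = v \<or> snd e = v) H)"

text \<open>Each element of \<open>us\<close> is a label with a key, and \<open>ds\<close>
  prescribes the key for each position; a label is removed once it is used. With degrees as keys
  this enumerates the degree-preserving bijections.\<close>

primrec injections :: "nat list \<Rightarrow> (nat \<times> nat) list \<Rightarrow> nat list list" where
  "injections [] us = [[]]"
| "injections (d # ds) us =
     concat (map (\<lambda>u. if snd u = d then map (Cons (fst u)) (injections ds (remove1 u us)) else []) us)"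

text \<open>Trying only the degree-preserving bijections keeps \<open>expand_arcs58\<close> below within reach of the simplifier.\<close>

definition candidates :: "arc_list \<Rightarrow> arc_list \<Rightarrow> nat list list" where
  "candidates H R = injections (map (arc_degree H) [1,2,3,4,5]) (map (\<lambda>v. (v, arc_degree R v)) [1,2,3,4,5])"

text \<open>Positions count from 1, like the vertices; the default 0 is not a vertex.\<close>

primrec lookup :: "nat list \<Rightarrow> nat \<Rightarrow> nat" where
  "lookup [] v = 0"
| "lookup (x # xs) v = (if v = 1 then x else lookup xs (v - 1))"

primrec first_match :: "nat list list \<Rightarrow> arc_list \<Rightarrow> arc_list \<Rightarrow> int" where
  "first_match [] H R = 0"
| "first_match (q # qs) H R = (if match_arcs (lookup q) H R = 0 then first_match qs H R else match_arcs (lookup q) H R)"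

text \<open>A pattern with an automorphism of sign \<open>-1\<close> has hom sum zero and gets the zero vector. Any other
  pattern has to match an element of the list, otherwise the result is \<^const>\<open>None\<close>.\<close>

primrec classify :: "arc_list list \<Rightarrow> arc_list \<Rightarrow> int list option" where
  "classify [] H = (if List.list_ex (\<lambda>q. match_arcs (lookup q) H H = -1) (candidates H H) then Some [] else None)"
| "classify (R # Rs) H =
    (if length H = length R \<and> first_match (candidates H R) H R \<noteq> 0 then Some (first_match (candidates H R) H R # map (\<lambda>_. 0) Rs)
     else map_option (Cons 0) (classify Rs H))"

primrec addv :: "int list \<Rightarrow> int list \<Rightarrow> int list" where
 "addv [] ys = []"
| "addv (x # xs) ys = (x + hd ys) # addv xs (tl ys)"

text \<open>Multiplies out the product of \<open>1 + A\<close>: the arcs in \<open>H\<close> have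
  been chosen with their factor \<open>A\<close>, those in the second argument are undecided, and
  each of them either joins \<open>H\<close> or contributes its 1.\<close>

primrec expand :: "arc_list list \<Rightarrow> arc_list \<Rightarrow> arc_list \<Rightarrow> int list option" where
  "expand Rs [] H = classify Rs H"
| "expand Rs (a # as) H =
    (case expand Rs as (a # H) of None \<Rightarrow> None | Some x \<Rightarrow> (case expand Rs as H of None \<Rightarrow> None | Some y \<Rightarrow> Some (addv x y)))"

locale skew_kernel =
  fixes V :: "'a set" and A :: "'a \<Rightarrow> 'a \<Rightarrow> real"
  assumes finite_V: "finite V"
    and skew: "A y x = - A x y"
    and bound: "\<bar>A x y\<bar> \<le> 1"
begin

text \<open>Every pattern is summed over five vertices; an isolated one only contributes a factor
  \<open>card V\<close>, which puts all patterns on a common scale.\<close>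

definition hom5 :: "arc_list \<Rightarrow> real" where
  "hom5 H = (\<Sum>f\<in>{1..5} \<rightarrow>\<^sub>E V. \<Prod>e\<leftarrow>H. A (f (fst e)) (f (snd e)))"

lemma match_arcs_prod:
  assumes "match_arcs p H R \<noteq> 0"
  shows "(\<Prod>e\<leftarrow>H. A (f (p (fst e))) (f (p (snd e)))) =
         of_int (match_arcs p H R) * (\<Prod>e\<leftarrow>R. A (f (fst e)) (f (snd e)))"
  using assms
proof (induction H arbitrary: R)
  case Nil
  then show ?case by (auto split: if_splits)
next
  case (Cons e H)
  have remove: "(\<Prod>e\<leftarrow>R. A (f (fst e)) (f (snd e))) =
      A (f i) (f j) * (\<Prod>e\<leftarrow>remove1 (i, j) R. A (f (fst e)) (f (snd e)))" if "(i, j) \<in> set R" for i j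
    using that by (induction R) (auto simp: algebra_simps)
  show ?case
    using Cons.prems Cons.IH remove skew[of "f (p (fst e))" "f (p (snd e))"]
    by (auto split: if_splits)
qed

lemma sum_PiE_relabel:
  assumes p: "bij_betw p I I"
  shows "(\<Sum>f\<in>I \<rightarrow>\<^sub>E V. g (restrict (f \<circ> p) I)) = (\<Sum>f\<in>I \<rightarrow>\<^sub>E V. g f)"
proof (rule sum.reindex_bij_witness[of _ "\<lambda>f. restrict (f \<circ> inv_into I p) I" "\<lambda>f. restrict (f \<circ> p) I"])
  fix f assume f: "f \<in> I \<rightarrow>\<^sub>E V"
  have pI: "p i \<in> I" "inv_into I p i \<in> I" "p (inv_into I p i) = i" "inv_into I p (p i) = i" if "i \<in> I" for i
    using p that by (auto simp: bij_betw_def inv_into_into f_inv_into_f)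
  show "restrict (restrict (f \<circ> p) I \<circ> inv_into I p) I = f"
    using f pI by (auto simp: fun_eq_iff PiE_def extensional_def)
  show "restrict (restrict (f \<circ> inv_into I p) I \<circ> p) I = f"
    using f pI by (auto simp: fun_eq_iff PiE_def extensional_def)
  show "restrict (f \<circ> p) I \<in> I \<rightarrow>\<^sub>E V" "restrict (f \<circ> inv_into I p) I \<in> I \<rightarrow>\<^sub>E V"
    using f pI by (auto simp: PiE_def)
qed auto

text \<open>Precomposition with \<open>p\<close> permutes the maps, so the sum is unchanged; every
  reversed arc contributes a factor -1 by skewness.\<close>

lemma hom5_match:
  assumes p: "bij_betw p {1..5} {1..5}" and H: "set H \<subseteq> {1..5} \<times> {1..5}" and m: "match_arcs p H R \<noteq> 0"
  shows "hom5 H = of_int (match_arcs p H R) * hom5 R"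
proof -
  have "hom5 H = (\<Sum>f\<in>{1..5} \<rightarrow>\<^sub>E V. \<Prod>e\<leftarrow>H. A (restrict (f \<circ> p) {1..5} (fst e)) (restrict (f \<circ> p) {1..5} (snd e)))"
    unfolding hom5_def by (rule sum_PiE_relabel[OF p, symmetric])
  also have "\<dots> = (\<Sum>f\<in>{1..5} \<rightarrow>\<^sub>E V. \<Prod>e\<leftarrow>H. A (f (p (fst e))) (f (p (snd e))))"
    using H by (intro sum.cong arg_cong[of _ _ prod_list] map_cong refl) auto
  also have "\<dots> = of_int (match_arcs p H R) * hom5 R"
    by (simp add: match_arcs_prod[OF m] hom5_def sum_distrib_left)
  finally show ?thesis .
qed

end

lemma injections_distinct:
  assumes "q \<in> set (injections ds us)" "distinct (map fst us)"
  shows "distinct q \<and> set q \<subseteq> fst ` set us \<and> length q = length ds"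
  using assms
proof (induction ds arbitrary: q us)
  case (Cons d ds)
  then obtain u q' where u: "u \<in> set us" "q = fst u # q'" "q' \<in> set (injections ds (remove1 u us))"
    by (auto split: if_splits)
  obtain xs ys where us: "us = xs @ u # ys" "u \<notin> set xs"
    using u(1) by (meson split_list_first)
  have r: "remove1 u us = xs @ ys" using us by (simp add: remove1_append)
  have "distinct (map fst (remove1 u us))" using Cons.prems(2) us r by auto
  from Cons.IH[OF u(3) this] show ?case using u us r Cons.prems(2) by auto
qed auto

lemma lookup_nth: "v \<ge> 1 \<Longrightarrow> v \<le> length q \<Longrightarrow> lookup q v = q ! (v - 1)"
proof (induction q arbitrary: v)
  case (Cons x q)
  then show ?case by (cases "v - 1") (auto simp: nth_Cons' Suc_diff_le numeral_2_eq_2)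
qed simp

lemma bij_lookup_candidates:
  assumes "q \<in> set (candidates H R)"
  shows "bij_betw (lookup q) {1..5} {1..5}"
proof -
  have q: "distinct q" "set q \<subseteq> {1..5}" "length q = 5"
    using injections_distinct[OF assms[unfolded candidates_def]] by (auto simp: comp_def)
  have "lookup q i = lookup q j \<longleftrightarrow> i = j" if "i \<in> {1..5}" "j \<in> {1..5}" for i j
  proof -
    have "i - 1 < length q" "j - 1 < length q" using that q by auto
    then have "q ! (i - 1) = q ! (j - 1) \<longleftrightarrow> i - 1 = j - 1" using nth_eq_iff_index_eq[OF q(1)] by blast
    also have "\<dots> \<longleftrightarrow> i = j" using that by auto
    finally show ?thesis using that q by (simp add: lookup_nth)
  qed
  then have "inj_on (lookup q) {1..5}" by (auto simp: inj_on_def)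
  moreover have "lookup q ` {1..5} \<subseteq> {1..5}"
  proof
    fix x assume "x \<in> lookup q ` {1..5}"
    then obtain i where "i \<in> {1..5}" "x = q ! (i - 1)" using q by (auto simp: lookup_nth)
    then have "x \<in> set q" using q(3) by (auto intro!: nth_mem)
    then show "x \<in> {1..5}" using q(2) by auto
  qed
  ultimately show ?thesis
    by (metis bij_betw_def endo_inj_surj finite_atLeastAtMost)
qed

lemma first_match_cases:
  assumes "first_match qs H R \<noteq> 0"
  obtains q where "q \<in> set qs" "match_arcs (lookup q) H R = first_match qs H R" "match_arcs (lookup q) H R \<noteq> 0"
  using assms by (induction qs) (auto split: if_splits)

context skew_kernel
begin

definition combination :: "int list \<Rightarrow> arc_list list \<Rightarrow> real" where
  "combination cs Rs = (\<Sum>(c, R)\<leftarrow>zip cs Rs. of_int c * hom5 R)"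

lemma combination_simps [simp]:
  "combination [] Rs = 0" "combination cs [] = 0"
  "combination (c # cs) (R # Rs) = of_int c * hom5 R + combination cs Rs"
  by (auto simp: combination_def)

lemma combination_zeros: "combination (map (\<lambda>_. 0) Rs) Rs = 0"
  by (induction Rs) auto

lemma combination_addv:
  "length xs = length Rs \<Longrightarrow> length ys = length Rs \<Longrightarrow>
   combination (addv xs ys) Rs = combination xs Rs + combination ys Rs"
proof (induction xs arbitrary: ys Rs)
  case (Cons x xs)
  then obtain R Rs' y ys' where "Rs = R # Rs'" "ys = y # ys'" by (metis length_Suc_conv)
  with Cons show ?case by (simp add: algebra_simps)
qed simp

lemma hom5_first_match:
  assumes "set H \<subseteq> {1..5} \<times> {1..5}" "first_match (candidates H R) H R \<noteq> 0"
  shows "hom5 H = of_int (first_match (candidates H R) H R) * hom5 R"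
proof -
  obtain q where q: "q \<in> set (candidates H R)" "match_arcs (lookup q) H R = first_match (candidates H R) H R"
    "match_arcs (lookup q) H R \<noteq> 0"
    using first_match_cases[OF assms(2)] by blast
  show ?thesis
    using hom5_match[OF bij_lookup_candidates[OF q(1)] assms(1) q(3)] q(2) by simp
qed

lemma classify_sound:
  assumes H: "set H \<subseteq> {1..5} \<times> {1..5}"
  shows "classify Rs H = Some cs \<Longrightarrow> length cs = length Rs \<and> hom5 H = combination cs Rs"
proof (induction Rs arbitrary: cs)
  case Nil
  then obtain q where q: "q \<in> set (candidates H H)" "match_arcs (lookup q) H H = -1" "cs = []"
    by (auto simp: list_ex_iff split: if_splits)
  have "hom5 H = - hom5 H"
    using hom5_match[OF bij_lookup_candidates[OF q(1)] H, of H] q(2) by simp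
  then show ?case using q by simp
next
  case (Cons R Rs)
  show ?case
  proof (cases "length H = length R \<and> first_match (candidates H R) H R \<noteq> 0")
    case True
    then show ?thesis using Cons.prems hom5_first_match[OF H] by (auto simp: combination_zeros)
  next
    case False
    then show ?thesis using Cons by (auto split: if_splits)
  qed
qed

lemma length_addv [simp]: "length (addv xs ys) = length xs"
  by (induction xs arbitrary: ys) auto

lemma expand_sound:
  assumes "set as \<subseteq> {1..5} \<times> {1..5}" "set H \<subseteq> {1..5} \<times> {1..5}" "expand Rs as H = Some cs"
  shows "length cs = length Rs \<and>
    (\<Sum>f\<in>{1..5} \<rightarrow>\<^sub>E V. (\<Prod>e\<leftarrow>as. 1 + A (f (fst e)) (f (snd e))) * (\<Prod>e\<leftarrow>H. A (f (fst e)) (f (snd e)))) =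
    combination cs Rs"
  using assms
proof (induction "as" arbitrary: H cs)
  case Nil
  then show ?case using classify_sound[of H Rs cs] by (simp add: hom5_def)
next
  case (Cons a "as")
  then obtain xs ys where xs: "expand Rs as (a # H) = Some xs" and ys: "expand Rs as H = Some ys"
    and cs: "cs = addv xs ys"
    by (auto split: option.splits)
  have 1: "length xs = length Rs \<and>
    (\<Sum>f\<in>{1..5} \<rightarrow>\<^sub>E V. (\<Prod>e\<leftarrow>as. 1 + A (f (fst e)) (f (snd e))) * (\<Prod>e\<leftarrow>a # H. A (f (fst e)) (f (snd e)))) =
    combination xs Rs"
    using Cons.prems by (intro Cons.IH[OF _ _ xs]) auto
  have 2: "length ys = length Rs \<and>
    (\<Sum>f\<in>{1..5} \<rightarrow>\<^sub>E V. (\<Prod>e\<leftarrow>as. 1 + A (f (fst e)) (f (snd e))) * (\<Prod>e\<leftarrow>H. A (f (fst e)) (f (snd e)))) =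
    combination ys Rs"
    using Cons.prems by (intro Cons.IH[OF _ _ ys]) auto
  have "(\<Sum>f\<in>{1..5} \<rightarrow>\<^sub>E V. (\<Prod>e\<leftarrow>a # as. 1 + A (f (fst e)) (f (snd e))) * (\<Prod>e\<leftarrow>H. A (f (fst e)) (f (snd e)))) =
     combination xs Rs + combination ys Rs"
    unfolding conjunct2[OF 1, symmetric] conjunct2[OF 2, symmetric] sum.distrib[symmetric]
    by (intro sum.cong) (auto simp: algebra_simps)
  then show ?case using 1 2 cs by (simp add: combination_addv)
qed

end

section \<open>A negative definite form on triples\<close>

lemma sum_PiE_insert:
  assumes "i \<notin> I"
  shows "(\<Sum>f\<in>insert i I \<rightarrow>\<^sub>E V. g f) = (\<Sum>x\<in>V. \<Sum>f\<in>I \<rightarrow>\<^sub>E V. g (f(i := x)))"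
proof -
  have inj: "inj_on (\<lambda>(x, f). f(i := x)) (V \<times> (I \<rightarrow>\<^sub>E V))"
    using assms by (rule inj_combinator)
  show ?thesis
    unfolding PiE_insert_eq sum.reindex[OF inj] by (simp add: sum.cartesian_product comp_def case_prod_unfold)
qed

text \<open>The coefficients were found by semidefinite programming. They are constrained by
  the identity \<open>triple_sum_eq\<close> below and by definiteness of the symmetrized form.
  The arguments stand for the arcs \<open>ab\<close>, \<open>bc\<close>, \<open>ac\<close> of a triple \<open>abc\<close>, the degree of \<open>a\<close>, the codegrees
  of \<open>ab\<close> and \<open>ac\<close>, and the joint degree of \<open>abc\<close>.\<close>

definition triple_form :: "real \<Rightarrow> real \<Rightarrow> real \<Rightarrow> real \<Rightarrow> real \<Rightarrow> real \<Rightarrow> real \<Rightarrow> real" where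
  "triple_form x y z u p r k =
     - 8 * u\<^sup>2 - 4 * (x * z * u\<^sup>2) + 7 * (k * u) + 9 * (x * u * r) - 12 * p\<^sup>2
     + 18 * (x * z * p\<^sup>2) + 16 * (x * z * u * k) + 14 * (x * y * z * u * p)
     - 15 * (x * k * r) - x * y * p * r - 16 * k\<^sup>2 + 8 * (z * y * p\<^sup>2) + 20 * (x * z * k\<^sup>2)"

text \<open>The sum of \<open>triple_form\<close> over the six orders of \<open>abc\<close>; here
  \<open>u\<close>, \<open>v\<close>, \<open>w\<close> belong to \<open>a\<close>, \<open>b\<close>,
  \<open>c\<close> and \<open>p\<close>, \<open>q\<close>, \<open>r\<close> to \<open>ab\<close>,
  \<open>bc\<close>, \<open>ac\<close>. A single \<open>triple_form\<close> is not negative: at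
  \<open>x = y = z = 1\<close> and \<open>u = r = k = 0\<close> it equals
  \<open>14 * p\<^sup>2\<close>.\<close>

definition sym_form ::
  "real \<Rightarrow> real \<Rightarrow> real \<Rightarrow> real \<Rightarrow> real \<Rightarrow> real \<Rightarrow> real \<Rightarrow> real \<Rightarrow> real \<Rightarrow> real \<Rightarrow> real" where
  "sym_form x y z u v w p q r k =
     triple_form x y z u p r k + triple_form z (- y) x u r p k +
     triple_form (- x) z y v p q k + triple_form y (- z) (- x) v q p k +
     triple_form (- z) x (- y) w r q k + triple_form (- y) (- x) (- z) w q r k"

text \<open>Squares are completed in the degrees before the other variables. The weights 24, 8, 24
  are twice \<open>8 + 4 * x * z\<close>, where the product of the two arcs leaving the vertex is 1
  at source and sink and -1 in the middle. The quarter is slack set aside for the codegrees.\<close>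

lemma sym_form_transitive: "sym_form 1 1 1 u v w p q r k \<le> - (p\<^sup>2 + q\<^sup>2 + r\<^sup>2) / 4"
proof -
  have "- sym_form 1 1 1 u v w p q r k - (p\<^sup>2 + q\<^sup>2 + r\<^sup>2) / 4 =
    24 * (u - 23/48 * p + 5/48 * r - 23/24 * k)\<^sup>2 + 8 * (v + 5/16 * p - 5/16 * q + 9/8 * k)\<^sup>2 +
    24 * (w + 23/48 * q - 5/48 * r - 23/24 * k)\<^sup>2 + 35/24 * (p - 3/20 * q + 23/28 * r + 4/5 * k)\<^sup>2 +
    2737/1920 * (q + 115/119 * r - 16/23 * k)\<^sup>2 + 435/476 * r\<^sup>2 + 31/184 * k\<^sup>2"
    unfolding sym_form_def triple_form_def by algebra
  also have "\<dots> \<ge> 0" by simp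
  finally show ?thesis by simp
qed

text \<open>The arcs \<open>ab\<close>, \<open>bc\<close>, \<open>ca\<close> form a cycle, so the
  form is invariant under rotation. What is left in the codegrees is then a combination of the
  square of their sum and the sum of their squares.\<close>

lemma sym_form_cyclic: "sym_form 1 1 (- 1) u v w p q r k \<le> - (p\<^sup>2 + q\<^sup>2 + r\<^sup>2) / 4"
proof -
  have "- sym_form 1 1 (- 1) u v w p q r k - (p\<^sup>2 + q\<^sup>2 + r\<^sup>2) / 4 =
    8 * (u + 23/16 * (p - r) + 9/8 * k)\<^sup>2 + 8 * (v + 23/16 * (q - p) + 9/8 * k)\<^sup>2 +
    8 * (w + 23/16 * (r - q) + 9/8 * k)\<^sup>2 + 561/32 * (p + q + r)\<^sup>2 +
    805/32 * (p\<^sup>2 + q\<^sup>2 + r\<^sup>2) + 1485/8 * k\<^sup>2"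
    unfolding sym_form_def triple_form_def minus_minus mult_minus_left mult_minus_right mult_1_left mult_1_right
    by algebra
  also have "\<dots> \<ge> 0" by simp
  finally show ?thesis by simp
qed

lemma sym_form_swap: "sym_form x y z u v w p q r k = sym_form (- x) z y v u w p r q k"
  by (simp add: sym_form_def)

lemma sym_form_rotate: "sym_form x y z u v w p q r k = sym_form y (- z) (- x) v w u q r p k"
  by (simp add: sym_form_def)

text \<open>The form is affine in each of its first three arguments, so it suffices to bound it at signs.\<close>

definition affine_fun :: "(real \<Rightarrow> real) \<Rightarrow> bool" where
  "affine_fun f \<longleftrightarrow> (\<exists>a b. \<forall>x. f x = a + b * x)"

lemma affine_funI: "(\<And>x. f x = a + b * x) \<Longrightarrow> affine_fun f"
  by (auto simp: affine_fun_def)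

lemma affine_fun_add:
  assumes "affine_fun f" "affine_fun g"
  shows "affine_fun (\<lambda>x. f x + g x)"
proof -
  obtain a b c d where "\<And>x. f x = a + b * x" "\<And>x. g x = c + d * x"
    using assms by (auto simp: affine_fun_def)
  then show ?thesis by (intro affine_funI[of _ "a + c" "b + d"]) (simp add: algebra_simps)
qed

lemma affine_fun_minus:
  assumes "affine_fun f"
  shows "affine_fun (\<lambda>x. f (- x))"
proof -
  obtain a b where "\<And>x. f x = a + b * x" using assms by (auto simp: affine_fun_def)
  then show ?thesis by (intro affine_funI[of _ a "- b"]) simp
qed

lemma affine_triple_form:
  "affine_fun (\<lambda>x. triple_form x y z u p r k)"
  "affine_fun (\<lambda>y. triple_form x y z u p r k)"
  "affine_fun (\<lambda>z. triple_form x y z u p r k)"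
  unfolding affine_fun_def triple_form_def
  subgoal
    by (rule exI[of _ "triple_form 0 y z u p r k"], rule exI[of _ "triple_form 1 y z u p r k - triple_form 0 y z u p r k"])
      (simp add: triple_form_def algebra_simps)
  subgoal
    by (rule exI[of _ "triple_form x 0 z u p r k"], rule exI[of _ "triple_form x 1 z u p r k - triple_form x 0 z u p r k"])
      (simp add: triple_form_def algebra_simps)
  subgoal
    by (rule exI[of _ "triple_form x y 0 u p r k"], rule exI[of _ "triple_form x y 1 u p r k - triple_form x y 0 u p r k"])
      (simp add: triple_form_def algebra_simps)
  done

lemmas affine_sym_form = affine_triple_form affine_triple_form[THEN affine_fun_minus] affine_fun_add

lemma affine_fun_le:
  assumes "affine_fun f" "f 1 \<le> c" "f (- 1) \<le> c" "\<bar>x\<bar> \<le> 1"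
  shows "f x \<le> c"
proof -
  obtain a b where f: "\<And>x. f x = a + b * x" using assms(1) by (auto simp: affine_fun_def)
  have "b * x \<le> \<bar>b\<bar>" using assms(4) abs_le_D1[of "b * x" "\<bar>b\<bar>"] by (simp add: abs_mult mult_left_le)
  then show ?thesis using assms(2,3) by (auto simp: f abs_if split: if_splits)
qed

lemma sym_form_le:
  assumes "\<bar>x\<bar> \<le> 1" "\<bar>y\<bar> \<le> 1" "\<bar>z\<bar> \<le> 1"
  shows "sym_form x y z u v w p q r k \<le> - (p\<^sup>2 + q\<^sup>2 + r\<^sup>2) / 4"
proof -
  \<comment> \<open>All degree variables are quantified because relabelling the triple permutes
    them.\<close>
  define B where "B x y z \<longleftrightarrow> (\<forall>u v w p q r k. sym_form x y z u v w p q r k \<le> - (p\<^sup>2 + q\<^sup>2 + r\<^sup>2) / 4)" for x y z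
  have swap: "B x y z" if "B (- x) z y" for x y z
    unfolding B_def
  proof (intro allI)
    fix u v w p q r k
    show "sym_form x y z u v w p q r k \<le> - (p\<^sup>2 + q\<^sup>2 + r\<^sup>2) / 4"
      using that[unfolded B_def, rule_format, of v u w p r q k] sym_form_swap[of x y z u v w p q r k]
      by (simp add: algebra_simps)
  qed
  have rotate: "B x y z" if "B y (- z) (- x)" for x y z
    unfolding B_def
  proof (intro allI)
    fix u v w p q r k
    show "sym_form x y z u v w p q r k \<le> - (p\<^sup>2 + q\<^sup>2 + r\<^sup>2) / 4"
      using that[unfolded B_def, rule_format, of v w u q r p k] sym_form_rotate[of x y z u v w p q r k]
      by (simp add: algebra_simps)
  qed
  \<comment> \<open>Of the eight sign vectors six are transitive and two cyclic; \<open>swap\<close>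
    and \<open>rotate\<close> generate all relabellings and carry these two cases to the
    rest.\<close>
  have 1: "B 1 1 1" "B 1 1 (-1)" using sym_form_transitive sym_form_cyclic by (auto simp: B_def)
  have 2: "B (-1) 1 1" "B (-1) (-1) 1"
    using swap[where x = "-1" and y = 1 and z = 1] swap[where x = "-1" and y = "-1" and z = 1] 1 by simp_all
  have 3: "B (-1) (-1) (-1)" using rotate[where x = "-1" and y = "-1" and z = "-1"] 2 by simp
  have 4: "B 1 (-1) 1" using rotate[where x = 1 and y = "-1" and z = 1] 3 by simp
  have 5: "B (-1) 1 (-1)" using swap[where x = "-1" and y = 1 and z = "-1"] 4 by simp
  have 6: "B 1 (-1) (-1)" using rotate[where x = 1 and y = "-1" and z = "-1"] 5 by simp
  have signs: "sym_form x y z u v w p q r k \<le> - (p\<^sup>2 + q\<^sup>2 + r\<^sup>2) / 4"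
    if "x \<in> {1, -1}" "y \<in> {1, -1}" "z \<in> {1, -1}" for x y z
  proof -
    have "B x y z" using that 1 2 3 4 5 6 by auto
    then show ?thesis by (simp add: B_def)
  qed
  have affine: "affine_fun (\<lambda>x. sym_form x y z u v w p q r k)" "affine_fun (\<lambda>y. sym_form x y z u v w p q r k)"
    "affine_fun (\<lambda>z. sym_form x y z u v w p q r k)" for x y z
    unfolding sym_form_def by (intro affine_sym_form)+
  have z: "sym_form x y z u v w p q r k \<le> - (p\<^sup>2 + q\<^sup>2 + r\<^sup>2) / 4"
    if "x \<in> {1, -1}" "y \<in> {1, -1}" for x y
    by (rule affine_fun_le[where f = "\<lambda>z. sym_form x y z u v w p q r k", OF affine(3) signs signs assms(3)])
      (use that in simp_all)
  have yz: "sym_form x y z u v w p q r k \<le> - (p\<^sup>2 + q\<^sup>2 + r\<^sup>2) / 4" if "x \<in> {1, -1}" for x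
    by (rule affine_fun_le[where f = "\<lambda>y. sym_form x y z u v w p q r k", OF affine(2) z z assms(2)])
      (use that in simp_all)
  show ?thesis
    by (rule affine_fun_le[where f = "\<lambda>x. sym_form x y z u v w p q r k", OF affine(1) yz yz assms(1)])
      simp_all
qed

section \<open>Hom sums as sums over vertex triples\<close>

definition related :: "int \<Rightarrow> arc_list \<Rightarrow> arc_list \<Rightarrow> bool" where
  "related m H R \<longleftrightarrow> m \<noteq> 0 \<and> first_match (candidates H R) H R = m \<and>
     list_all (\<lambda>e. fst e \<in> set [1..<6] \<and> snd e \<in> set [1..<6]) H"

definition cherry :: arc_list where "cherry = [(1,2),(1,3)]"
definition star3 :: arc_list where "star3 = [(1,2),(1,3),(1,4)]"
definition star4 :: arc_list where "star4 = [(1,2),(1,3),(1,4),(1,5)]"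
definition chair :: arc_list where "chair = [(1,2),(1,3),(1,4),(2,5)]"
definition cycle4 :: arc_list where "cycle4 = [(1,2),(1,3),(2,4),(3,4)]"
definition path5 :: arc_list where "path5 = [(1,2),(1,3),(2,4),(3,5)]"
definition banner :: arc_list where "banner = [(1,2),(1,3),(1,4),(2,5),(3,5)]"
definition book :: arc_list where "book = [(1,2),(1,3),(1,4),(1,5),(2,3),(2,4)]"
definition house :: arc_list where "house = [(1,2),(1,3),(1,4),(2,3),(2,5),(4,5)]"
definition k23 :: arc_list where "k23 = [(1,2),(1,3),(1,4),(2,5),(3,5),(4,5)]"
definition wheel :: arc_list where "wheel = [(1,2),(1,3),(1,4),(1,5),(2,3),(2,4),(3,5),(4,5)]"

context skew_kernel
begin

definition deg where "deg a = (\<Sum>t\<in>V. A a t)"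
definition codeg where "codeg a b = (\<Sum>t\<in>V. A a t * A b t)"
definition tridegree where "tridegree a b c = (\<Sum>t\<in>V. A a t * A b t * A c t)"

lemma hom5_nested:
  "hom5 H = (\<Sum>a\<in>V. \<Sum>b\<in>V. \<Sum>c\<in>V. \<Sum>s\<in>V. \<Sum>t\<in>V.
     \<Prod>e\<leftarrow>H. A (((\<lambda>_. undefined)(5 := t, 4 := s, 3 := c, 2 := b, 1 := a)) (fst e))
       (((\<lambda>_. undefined)(5 := t, 4 := s, 3 := c, 2 := b, 1 := a)) (snd e)))"
proof -
  have I: "{1..5::nat} = {1,2,3,4,5}" by auto
  have "hom5 H = (\<Sum>a\<in>V. \<Sum>b\<in>V. \<Sum>c\<in>V. \<Sum>s\<in>V. \<Sum>t\<in>V. \<Sum>f\<in>{} \<rightarrow>\<^sub>E V.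
     \<Prod>e\<leftarrow>H. A ((f(5 := t, 4 := s, 3 := c, 2 := b, 1 := a)) (fst e))
       ((f(5 := t, 4 := s, 3 := c, 2 := b, 1 := a)) (snd e)))"
    unfolding hom5_def I by (subst sum_PiE_insert, simp)+ simp
  then show ?thesis by (simp only: PiE_empty_domain) simp
qed

lemma hom5_related: "related m H R \<Longrightarrow> hom5 H = of_int m * hom5 R"
  unfolding related_def using hom5_first_match[of H R] by (force simp: list_all_iff)

definition sum3 :: "('a \<Rightarrow> 'a \<Rightarrow> 'a \<Rightarrow> real) \<Rightarrow> real" where
  "sum3 F = (\<Sum>a\<in>V. \<Sum>b\<in>V. \<Sum>c\<in>V. F a b c)"

lemmas hom5_expand = hom5_nested sum3_def deg_def codeg_def tridegree_def power2_eq_square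
  sum_product sum_distrib_left sum_distrib_right mult_ac

text \<open>In this and the following identities the pattern is relabelled so that 4 and 5 are
  nonadjacent. With 1, 2, 3 sent to \<open>a\<close>, \<open>b\<close>, \<open>c\<close>, the sums
  over the images of 4 and 5 separate into a product of two factors, each a degree, codegree or
  joint degree according to the neighbours.\<close>

lemma hom5_cherry: "hom5 cherry = sum3 (\<lambda>a b c. (deg a)\<^sup>2)"
proof -
  have "related 1 cherry [(1,4),(1,5)]" by code_simp
  from hom5_related[OF this] have "hom5 cherry = hom5 [(1,4),(1,5)]" by simp
  also have "hom5 [(1,4),(1,5)] = sum3 (\<lambda>a b c. (deg a)\<^sup>2)" by (simp add: hom5_expand)
  finally show ?thesis .
qed

lemma hom5_star4: "hom5 star4 = sum3 (\<lambda>a b c. A a b * A a c * (deg a)\<^sup>2)"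
proof -
  have "related 1 star4 [(1,2),(1,3),(1,4),(1,5)]" by code_simp
  from hom5_related[OF this] have "hom5 star4 = hom5 [(1,2),(1,3),(1,4),(1,5)]" by simp
  also have "hom5 [(1,2),(1,3),(1,4),(1,5)] = sum3 (\<lambda>a b c. A a b * A a c * (deg a)\<^sup>2)" by (simp add: hom5_expand)
  finally show ?thesis .
qed

lemma hom5_chair1: "hom5 chair = - sum3 (\<lambda>a b c. tridegree a b c * deg a)"
proof -
  have "related (-1) chair [(1,4),(2,4),(3,4),(1,5)]" by code_simp
  from hom5_related[OF this] have "hom5 chair = - hom5 [(1,4),(2,4),(3,4),(1,5)]" by simp
  also have "hom5 [(1,4),(2,4),(3,4),(1,5)] = sum3 (\<lambda>a b c. tridegree a b c * deg a)" by (simp add: hom5_expand)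
  finally show ?thesis .
qed

lemma hom5_chair2: "hom5 chair = - sum3 (\<lambda>a b c. A a b * deg a * codeg a c)"
proof -
  have "related (-1) chair [(1,2),(1,4),(1,5),(3,5)]" by code_simp
  from hom5_related[OF this] have "hom5 chair = - hom5 [(1,2),(1,4),(1,5),(3,5)]" by simp
  also have "hom5 [(1,2),(1,4),(1,5),(3,5)] = sum3 (\<lambda>a b c. A a b * deg a * codeg a c)" by (simp add: hom5_expand)
  finally show ?thesis .
qed

lemma hom5_cycle4: "hom5 cycle4 = sum3 (\<lambda>a b c. (codeg a b)\<^sup>2)"
proof -
  have "related 1 cycle4 [(1,4),(2,4),(1,5),(2,5)]" by code_simp
  from hom5_related[OF this] have "hom5 cycle4 = hom5 [(1,4),(2,4),(1,5),(2,5)]" by simp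
  also have "hom5 [(1,4),(2,4),(1,5),(2,5)] = sum3 (\<lambda>a b c. (codeg a b)\<^sup>2)" by (simp add: hom5_expand)
  finally show ?thesis .
qed

lemma hom5_book1: "hom5 book = sum3 (\<lambda>a b c. A a b * A a c * (codeg a b)\<^sup>2)"
proof -
  have "related 1 book [(1,2),(1,3),(1,4),(2,4),(1,5),(2,5)]" by code_simp
  from hom5_related[OF this] have "hom5 book = hom5 [(1,2),(1,3),(1,4),(2,4),(1,5),(2,5)]" by simp
  also have "hom5 [(1,2),(1,3),(1,4),(2,4),(1,5),(2,5)] = sum3 (\<lambda>a b c. A a b * A a c * (codeg a b)\<^sup>2)" by (simp add: hom5_expand)
  finally show ?thesis .
qed

lemma hom5_book2: "hom5 book = sum3 (\<lambda>a b c. A a b * A a c * deg a * tridegree a b c)"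
proof -
  have "related 1 book [(1,2),(1,3),(1,4),(1,5),(2,5),(3,5)]" by code_simp
  from hom5_related[OF this] have "hom5 book = hom5 [(1,2),(1,3),(1,4),(1,5),(2,5),(3,5)]" by simp
  also have "hom5 [(1,2),(1,3),(1,4),(1,5),(2,5),(3,5)] = sum3 (\<lambda>a b c. A a b * A a c * deg a * tridegree a b c)" by (simp add: hom5_expand)
  finally show ?thesis .
qed

lemma hom5_book3: "hom5 book = sum3 (\<lambda>a b c. A a b * A b c * A a c * deg a * codeg a b)"
proof -
  have "related 1 book [(1,2),(2,3),(1,3),(1,4),(1,5),(2,5)]" by code_simp
  from hom5_related[OF this] have "hom5 book = hom5 [(1,2),(2,3),(1,3),(1,4),(1,5),(2,5)]" by simp
  also have "hom5 [(1,2),(2,3),(1,3),(1,4),(1,5),(2,5)] = sum3 (\<lambda>a b c. A a b * A b c * A a c * deg a * codeg a b)" by (simp add: hom5_expand)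
  finally show ?thesis .
qed

lemma hom5_house1: "hom5 house = - sum3 (\<lambda>a b c. A a b * tridegree a b c * codeg a c)"
proof -
  have "related (-1) house [(1,2),(1,4),(2,4),(3,4),(1,5),(3,5)]" by code_simp
  from hom5_related[OF this] have "hom5 house = - hom5 [(1,2),(1,4),(2,4),(3,4),(1,5),(3,5)]" by simp
  also have "hom5 [(1,2),(1,4),(2,4),(3,4),(1,5),(3,5)] = sum3 (\<lambda>a b c. A a b * tridegree a b c * codeg a c)" by (simp add: hom5_expand)
  finally show ?thesis .
qed

lemma hom5_house2: "hom5 house = - sum3 (\<lambda>a b c. A a b * A b c * codeg a b * codeg a c)"
proof -
  have "related (-1) house [(1,2),(2,3),(1,4),(2,4),(1,5),(3,5)]" by code_simp
  from hom5_related[OF this] have "hom5 house = - hom5 [(1,2),(2,3),(1,4),(2,4),(1,5),(3,5)]" by simp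
  also have "hom5 [(1,2),(2,3),(1,4),(2,4),(1,5),(3,5)] = sum3 (\<lambda>a b c. A a b * A b c * codeg a b * codeg a c)" by (simp add: hom5_expand)
  finally show ?thesis .
qed

lemma hom5_k231: "hom5 k23 = - sum3 (\<lambda>a b c. (tridegree a b c)\<^sup>2)"
proof -
  have "related (-1) k23 [(1,4),(2,4),(3,4),(1,5),(2,5),(3,5)]" by code_simp
  from hom5_related[OF this] have "hom5 k23 = - hom5 [(1,4),(2,4),(3,4),(1,5),(2,5),(3,5)]" by simp
  also have "hom5 [(1,4),(2,4),(3,4),(1,5),(2,5),(3,5)] = sum3 (\<lambda>a b c. (tridegree a b c)\<^sup>2)" by (simp add: hom5_expand)
  finally show ?thesis .
qed

lemma hom5_k232: "hom5 k23 = - sum3 (\<lambda>a b c. A a c * A b c * (codeg a b)\<^sup>2)"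
proof -
  have "related (-1) k23 [(1,3),(2,3),(1,4),(2,4),(1,5),(2,5)]" by code_simp
  from hom5_related[OF this] have "hom5 k23 = - hom5 [(1,3),(2,3),(1,4),(2,4),(1,5),(2,5)]" by simp
  also have "hom5 [(1,3),(2,3),(1,4),(2,4),(1,5),(2,5)] = sum3 (\<lambda>a b c. A a c * A b c * (codeg a b)\<^sup>2)" by (simp add: hom5_expand)
  finally show ?thesis .
qed

lemma hom5_wheel: "hom5 wheel = sum3 (\<lambda>a b c. A a b * A a c * (tridegree a b c)\<^sup>2)"
proof -
  have "related 1 wheel [(1,2),(1,3),(1,4),(2,4),(3,4),(1,5),(2,5),(3,5)]" by code_simp
  from hom5_related[OF this] have "hom5 wheel = hom5 [(1,2),(1,3),(1,4),(2,4),(3,4),(1,5),(2,5),(3,5)]" by simp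
  also have "hom5 [(1,2),(1,3),(1,4),(2,4),(3,4),(1,5),(2,5),(3,5)] = sum3 (\<lambda>a b c. A a b * A a c * (tridegree a b c)\<^sup>2)" by (simp add: hom5_expand)
  finally show ?thesis .
qed

text \<open>With the centre fixed, the four leaves are summed independently, which leaves the fourth
  power of its degree.\<close>

lemma hom5_star4_nonneg: "hom5 star4 \<ge> 0"
proof -
  have "hom5 star4 = (\<Sum>a\<in>V. (deg a)\<^sup>2 * (deg a)\<^sup>2)"
    by (simp add: hom5_expand star4_def)
  then show ?thesis by (simp add: sum_nonneg)
qed

lemma sum3_linear:
  "sum3 (\<lambda>a b c. F a b c + G a b c) = sum3 F + sum3 G"
  "sum3 (\<lambda>a b c. F a b c - G a b c) = sum3 F - sum3 G"
  "sum3 (\<lambda>a b c. r * F a b c) = r * sum3 F"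
  by (simp_all add: sum3_def sum.distrib sum_subtractf sum_distrib_left)

lemma sum3_swap:
  "sum3 (\<lambda>a b c. F a c b) = sum3 F" "sum3 (\<lambda>a b c. F b a c) = sum3 F"
proof -
  show "sum3 (\<lambda>a b c. F a c b) = sum3 F"
    unfolding sum3_def by (intro sum.cong refl sum.swap)
  show "sum3 (\<lambda>a b c. F b a c) = sum3 F"
    unfolding sum3_def by (rule sum.swap)
qed

lemma sum3_symmetrize:
  "sum3 (\<lambda>a b c. F a b c + F a c b + F b a c + F b c a + F c a b + F c b a) = 6 * sum3 F"
proof -
  have 1: "sum3 (\<lambda>a b c. F b c a) = sum3 F"
    using sum3_swap(2)[of "\<lambda>a b c. F a c b"] sum3_swap(1)[of F] by simp
  have 2: "sum3 (\<lambda>a b c. F c a b) = sum3 F"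
    using sum3_swap(1)[of "\<lambda>a b c. F b a c"] sum3_swap(2)[of F] by simp
  have 3: "sum3 (\<lambda>a b c. F c b a) = sum3 F"
    using sum3_swap(2)[of "\<lambda>a b c. F c a b"] 2 by simp
  show ?thesis
    using sum3_swap(1)[of F] sum3_swap(2)[of F] 1 2 3 by (simp add: sum3_linear)
qed

definition triple_sum :: real where
  "triple_sum = sum3 (\<lambda>a b c.
     triple_form (A a b) (A b c) (A a c) (deg a) (codeg a b) (codeg a c) (tridegree a b c))"

text \<open>The different expressions of one pattern recombine: 7 + 9 for \<open>chair\<close>, 18 +
  16 + 14 for \<open>book\<close>, 15 + 1 for \<open>house\<close>, 16 - 8 for \<open>k23\<close>.
  Apart from \<open>star4\<close> the totals are four times the coefficients in the expansion of the
  ten arcs.\<close>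

lemma triple_sum_eq:
  "triple_sum = - 8 * hom5 cherry - 4 * hom5 star4 - 16 * hom5 chair - 12 * hom5 cycle4
     + 48 * hom5 book + 16 * hom5 house + 8 * hom5 k23 + 20 * hom5 wheel"
  unfolding triple_sum_def triple_form_def sum3_linear
  using hom5_chair1 hom5_chair2 hom5_book1 hom5_book2 hom5_book3 hom5_house1 hom5_house2 hom5_k231 hom5_k232
    hom5_cherry hom5_star4 hom5_cycle4 hom5_wheel by linarith

lemma codeg_commute: "codeg a b = codeg b a"
  by (simp add: codeg_def mult.commute)

lemma triple_sum_le: "triple_sum \<le> - real (card V) / 8 * (\<Sum>a\<in>V. \<Sum>b\<in>V. (codeg a b)\<^sup>2)"
proof -
  let ?F = "\<lambda>a b c. triple_form (A a b) (A b c) (A a c) (deg a) (codeg a b) (codeg a c) (tridegree a b c)"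
  have sym: "?F a b c + ?F a c b + ?F b a c + ?F b c a + ?F c a b + ?F c b a =
      sym_form (A a b) (A b c) (A a c) (deg a) (deg b) (deg c) (codeg a b) (codeg b c) (codeg a c) (tridegree a b c)"
    for a b c
  proof -
    have tri: "tridegree a c b = tridegree a b c" "tridegree b a c = tridegree a b c"
      "tridegree b c a = tridegree a b c" "tridegree c a b = tridegree a b c" "tridegree c b a = tridegree a b c"
      by (simp_all add: tridegree_def mult_ac)
    show ?thesis
      unfolding sym_form_def tri skew[where x = a and y = b] skew[where x = b and y = c] skew[where x = a and y = c]
        codeg_commute[of b a] codeg_commute[of c b] codeg_commute[of c a] by simp
  qed
  have le: "sym_form x y z u v w p q r k \<le> (- 1 / 4) * (p\<^sup>2 + q\<^sup>2 + r\<^sup>2)"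
    if "\<bar>x\<bar> \<le> 1" "\<bar>y\<bar> \<le> 1" "\<bar>z\<bar> \<le> 1" for x y z u v w p q r k
  proof -
    have "- (p\<^sup>2 + q\<^sup>2 + r\<^sup>2) / 4 = (- 1 / 4) * (p\<^sup>2 + q\<^sup>2 + r\<^sup>2)" by (rule minus_divide_left[symmetric, THEN trans]) simp
    then show ?thesis using sym_form_le[OF that, of u v w p q r k] by (simp only:)
  qed
  have "6 * triple_sum = sum3 (\<lambda>a b c. ?F a b c + ?F a c b + ?F b a c + ?F b c a + ?F c a b + ?F c b a)"
    unfolding triple_sum_def by (rule sum3_symmetrize[symmetric])
  also have "\<dots> \<le> sum3 (\<lambda>a b c. (- 1 / 4) * ((codeg a b)\<^sup>2 + (codeg b c)\<^sup>2 + (codeg a c)\<^sup>2))"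
    unfolding sym sum3_def by (intro sum_mono le bound)
  also have "\<dots> = (- 1 / 4) * (sum3 (\<lambda>a b c. (codeg a b)\<^sup>2) + sum3 (\<lambda>a b c. (codeg b c)\<^sup>2) + sum3 (\<lambda>a b c. (codeg a c)\<^sup>2))"
    by (simp only: sum3_linear)
  finally have sum: "6 * triple_sum \<le> (- 1 / 4) * (sum3 (\<lambda>a b c. (codeg a b)\<^sup>2) +
      sum3 (\<lambda>a b c. (codeg b c)\<^sup>2) + sum3 (\<lambda>a b c. (codeg a c)\<^sup>2))" .
  define N where "N = real (card V) * (\<Sum>a\<in>V. \<Sum>b\<in>V. (codeg a b)\<^sup>2)"
  have 1: "sum3 (\<lambda>a b c. (codeg a b)\<^sup>2) = N"
    by (simp add: sum3_def sum_distrib_left N_def)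
  have 2: "sum3 (\<lambda>a b c. (codeg b c)\<^sup>2) = N"
    by (simp add: sum3_def N_def)
  have 3: "sum3 (\<lambda>a b c. (codeg a c)\<^sup>2) = N"
    using sum3_swap(1)[of "\<lambda>a b c. (codeg a b)\<^sup>2"] 1 by (rule trans)
  \<comment> \<open>Three codegree sums of weight 1/4, shared among six orders.\<close>
  have "triple_sum \<le> - (1 / 8) * N"
    using sum[unfolded 1 2 3] by simp
  then show ?thesis by (simp add: N_def)
qed

end

section \<open>The expansion over the ten arcs\<close>

definition arcs58 :: arc_list where
  "arcs58 = [(1,2), (1,3), (1,4), (2,3), (2,4), (2,5), (3,4), (4,5), (5,1), (5,3)]"

text \<open>Every pattern without a sign-reversing automorphism has to be listed, including
  \<open>star3\<close>, \<open>path5\<close> and \<open>banner\<close>, whose total coefficient is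
  0. For \<open>star3\<close> and \<open>banner\<close>, with an odd number of arcs, the
  cancellation reflects a symmetry: exchanging 1 with 4 and 2 with 3 reverses all arcs of
  \<open>T58\<close>.\<close>

definition patterns :: "arc_list list" where
  "patterns = [[], cherry, star3, star4, chair, cycle4, path5, banner, book, house, k23, wheel]"

text \<open>Only the isomorphism types listed in \<^const>\<open>patterns\<close> survive among the 1024 sub-patterns.\<close>

lemma expand_arcs58: "expand patterns arcs58 [] = Some [1, - 2, 0, - 3, - 4, - 3, 0, 0, 12, 4, 2, 5]"
  by code_simp

context skew_kernel
begin

lemma hom5_Nil: "hom5 [] = real (card V) ^ 5"
  by (simp add: hom5_nested eval_nat_numeral)

lemma sum_arcs58_le:
  "(\<Sum>f\<in>{1..5} \<rightarrow>\<^sub>E V. \<Prod>e\<leftarrow>arcs58. 1 + A (f (fst e)) (f (snd e))) \<le>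
     real (card V) ^ 5 - real (card V) / 32 * (\<Sum>a\<in>V. \<Sum>b\<in>V. (codeg a b)\<^sup>2)"
proof -
  have arcs: "set arcs58 \<subseteq> {1..5} \<times> {1..5}"
    by (simp add: arcs58_def)
  have "(\<Sum>f\<in>{1..5} \<rightarrow>\<^sub>E V. \<Prod>e\<leftarrow>arcs58. 1 + A (f (fst e)) (f (snd e))) =
      combination [1, - 2, 0, - 3, - 4, - 3, 0, 0, 12, 4, 2, 5] patterns"
    using expand_sound[OF arcs _ expand_arcs58] by simp
  \<comment> \<open>The expansion contains \<open>- 3 * hom5 star4\<close>, of which
    \<open>triple_sum\<close> accounts for one third. The rest is nonpositive and treated apart:
    inside the form it would make the coefficient of the squared degree positive when
    \<open>x * z = -1\<close>.\<close>
  also have "\<dots> = real (card V) ^ 5 + (triple_sum - 8 * hom5 star4) / 4"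
    by (simp add: patterns_def hom5_Nil triple_sum_eq)
  finally have "(\<Sum>f\<in>{1..5} \<rightarrow>\<^sub>E V. \<Prod>e\<leftarrow>arcs58. 1 + A (f (fst e)) (f (snd e))) \<le> real (card V) ^ 5 + triple_sum / 4"
    using hom5_star4_nonneg by simp
  also have "\<dots> \<le> real (card V) ^ 5 + (- real (card V) / 8 * (\<Sum>a\<in>V. \<Sum>b\<in>V. (codeg a b)\<^sup>2)) / 4"
    by (intro add_left_mono divide_right_mono triple_sum_le) simp
  finally show ?thesis by simp
qed

section \<open>Few signed 4-cycles force all signed patterns to be negligible\<close>

text \<open>Cauchy-Schwarz over \<open>x\<close> removes the weight \<open>g\<close> and leaves
  codegrees of pairs; Cauchy-Schwarz over these pairs removes \<open>h\<close>. Each application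
  squares the sum, hence the fourth power.\<close>

lemma bilinear_sum_le:
  assumes g: "\<And>x. \<bar>g x\<bar> \<le> 1" and h: "\<And>y. \<bar>h y\<bar> \<le> 1"
  shows "\<bar>\<Sum>x\<in>V. \<Sum>y\<in>V. A x y * g x * h y\<bar> ^ 4 \<le>
    real (card V) ^ 4 * (\<Sum>a\<in>V. \<Sum>b\<in>V. (codeg a b)\<^sup>2)"
proof -
  let ?n = "real (card V)" and ?C = "\<Sum>a\<in>V. \<Sum>b\<in>V. (codeg a b)\<^sup>2"
  let ?r = "\<lambda>x. \<Sum>y\<in>V. A x y * h y"
  \<comment> \<open>The first application produces codegrees of columns; by skewness they agree with
    those of rows.\<close>
  have codeg': "codeg a b = (\<Sum>x\<in>V. A x a * A x b)" for a b
    by (simp add: codeg_def skew[of a] skew[of b])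
  have "(\<Sum>x\<in>V. \<Sum>y\<in>V. A x y * g x * h y) = (\<Sum>x\<in>V. g x * ?r x)"
    by (simp add: sum_distrib_left mult_ac)
  then have "(\<Sum>x\<in>V. \<Sum>y\<in>V. A x y * g x * h y)\<^sup>2 \<le> (\<Sum>x\<in>V. (g x)\<^sup>2) * (\<Sum>x\<in>V. (?r x)\<^sup>2)"
    using Cauchy_Schwarz_ineq_sum[of g ?r V] by simp
  also have "\<dots> \<le> ?n * (\<Sum>x\<in>V. (?r x)\<^sup>2)"
  proof (rule mult_right_mono)
    have "(\<Sum>x\<in>V. (g x)\<^sup>2) \<le> (\<Sum>x\<in>V. 1)"
      using g by (intro sum_mono) (simp add: abs_square_le_1)
    then show "(\<Sum>x\<in>V. (g x)\<^sup>2) \<le> ?n" by simp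
  qed (simp add: sum_nonneg)
  also have "(\<Sum>x\<in>V. (?r x)\<^sup>2) = (\<Sum>a\<in>V. \<Sum>b\<in>V. h a * h b * codeg a b)"
  proof -
    have "(\<Sum>x\<in>V. (?r x)\<^sup>2) = (\<Sum>x\<in>V. \<Sum>a\<in>V. \<Sum>b\<in>V. h a * h b * (A x a * A x b))"
      by (simp add: power2_eq_square sum_product mult_ac)
    also have "\<dots> = (\<Sum>a\<in>V. \<Sum>b\<in>V. \<Sum>x\<in>V. h a * h b * (A x a * A x b))"
      by (subst sum.swap) (intro sum.cong refl sum.swap)
    finally show ?thesis by (simp add: codeg' sum_distrib_left)
  qed
  finally have 1: "(\<Sum>x\<in>V. \<Sum>y\<in>V. A x y * g x * h y)\<^sup>2 \<le> ?n * (\<Sum>a\<in>V. \<Sum>b\<in>V. h a * h b * codeg a b)" .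
  have 2: "(\<Sum>a\<in>V. \<Sum>b\<in>V. h a * h b * codeg a b)\<^sup>2 \<le> ?n\<^sup>2 * ?C"
  proof -
    have "(\<Sum>a\<in>V. \<Sum>b\<in>V. h a * h b * codeg a b)\<^sup>2 =
        (\<Sum>p\<in>V \<times> V. (h (fst p) * h (snd p)) * codeg (fst p) (snd p))\<^sup>2"
      by (simp add: sum.cartesian_product case_prod_unfold)
    also have "\<dots> \<le> (\<Sum>p\<in>V \<times> V. (h (fst p) * h (snd p))\<^sup>2) * (\<Sum>p\<in>V \<times> V. (codeg (fst p) (snd p))\<^sup>2)"
      by (rule Cauchy_Schwarz_ineq_sum)
    also have "\<dots> \<le> ?n\<^sup>2 * (\<Sum>p\<in>V \<times> V. (codeg (fst p) (snd p))\<^sup>2)"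
    proof (rule mult_right_mono)
      have "(\<Sum>p\<in>V \<times> V. (h (fst p) * h (snd p))\<^sup>2) \<le> (\<Sum>p\<in>V \<times> V. 1)"
        using h by (intro sum_mono) (simp add: abs_square_le_1 abs_mult mult_le_one)
      then show "(\<Sum>p\<in>V \<times> V. (h (fst p) * h (snd p))\<^sup>2) \<le> ?n\<^sup>2"
        by (simp add: power2_eq_square card_cartesian_product)
    qed (simp add: sum_nonneg)
    also have "(\<Sum>p\<in>V \<times> V. (codeg (fst p) (snd p))\<^sup>2) = ?C"
      by (simp add: sum.cartesian_product case_prod_unfold)
    finally show ?thesis .
  qed
  have "\<bar>\<Sum>x\<in>V. \<Sum>y\<in>V. A x y * g x * h y\<bar> ^ 4 = ((\<Sum>x\<in>V. \<Sum>y\<in>V. A x y * g x * h y)\<^sup>2)\<^sup>2"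
    by simp
  also have "\<dots> \<le> (?n * (\<Sum>a\<in>V. \<Sum>b\<in>V. h a * h b * codeg a b))\<^sup>2"
    by (rule power_mono[OF 1]) simp
  also have "\<dots> \<le> ?n\<^sup>2 * (?n\<^sup>2 * ?C)"
    unfolding power_mult_distrib by (rule mult_left_mono[OF 2]) simp
  finally show ?thesis by (simp add: power2_eq_square power4_eq_xxxx mult.assoc)
qed

text \<open>A nonempty signed pattern is counted by fixing all but the two ends of one of its arcs.\<close>

lemma pattern_sum_le:
  assumes I: "finite I" and uv: "(u, v) \<in> E" and E: "E \<subseteq> I \<times> I"
    and simple: "u \<noteq> v" "(v, u) \<notin> E"
  shows "\<bar>\<Sum>f\<in>I \<rightarrow>\<^sub>E V. \<Prod>e\<in>E. A (f (fst e)) (f (snd e))\<bar> \<le>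
    real (card V) ^ (card I - 1) * root 4 (\<Sum>a\<in>V. \<Sum>b\<in>V. (codeg a b)\<^sup>2)"
proof -
  let ?n = "real (card V)" and ?C = "\<Sum>a\<in>V. \<Sum>b\<in>V. (codeg a b)\<^sup>2"
  have finE: "finite E" using E I finite_subset by blast
  define J where "J = I - {u, v}"
  have IJ: "I = insert u (insert v J)" "u \<notin> insert v J" "v \<notin> J"
    using uv E simple by (auto simp: J_def)
  have cardI: "card I - 1 = Suc (card J)"
    using I IJ by (metis card_insert_disjoint diff_Suc_1 finite_insert)
  have root_bound: "\<bar>\<Sum>x\<in>V. \<Sum>y\<in>V. A x y * g x * h y\<bar> \<le> ?n * root 4 ?C"
    if "\<And>x. \<bar>g x\<bar> \<le> 1" "\<And>y. \<bar>h y\<bar> \<le> 1" for g h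
  proof -
    have "\<bar>\<Sum>x\<in>V. \<Sum>y\<in>V. A x y * g x * h y\<bar> = root 4 (\<bar>\<Sum>x\<in>V. \<Sum>y\<in>V. A x y * g x * h y\<bar> ^ 4)"
      by (subst real_root_power_cancel) auto
    also have "\<dots> \<le> root 4 (?n ^ 4 * ?C)"
      by (rule real_root_le_mono) (use bilinear_sum_le that in auto)
    also have "\<dots> = ?n * root 4 ?C"
      by (simp add: real_root_mult real_root_power_cancel)
    finally show ?thesis .
  qed
  define D where "D = E - {(u, v)}"
  \<comment> \<open>No remaining arc joins \<open>u\<close> and \<open>v\<close>. With the other
    vertices fixed, the arcs at \<open>u\<close> therefore depend on \<open>x\<close> alone and
    supply the weight \<open>g\<close>, while the others do not depend on \<open>x\<close> and
    supply \<open>h\<close>.\<close>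
  define E1 where "E1 = {e \<in> D. fst e = u \<or> snd e = u}"
  define E2 where "E2 = {e \<in> D. fst e \<noteq> u \<and> snd e \<noteq> u}"
  have D: "finite D" "D = E1 \<union> E2" "E1 \<inter> E2 = {}" "finite E1" "finite E2"
    using finE by (auto simp: D_def E1_def E2_def)
  have abs_prod: "\<bar>\<Prod>e\<in>F. A (f (fst e)) (f (snd e))\<bar> \<le> 1" for F and f :: "'c \<Rightarrow> 'a"
    unfolding abs_prod by (intro prod_le_1) (auto simp: bound)
  have inner: "\<bar>\<Sum>x\<in>V. \<Sum>y\<in>V. \<Prod>e\<in>E. A ((f(v := y, u := x)) (fst e)) ((f(v := y, u := x)) (snd e))\<bar> \<le> ?n * root 4 ?C" for f
  proof -
    let ?g = "\<lambda>x. \<Prod>e\<in>E1. A ((f(u := x)) (fst e)) ((f(u := x)) (snd e))"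
    let ?h = "\<lambda>y. \<Prod>e\<in>E2. A ((f(v := y)) (fst e)) ((f(v := y)) (snd e))"
    have "(\<Prod>e\<in>E. A ((f(v := y, u := x)) (fst e)) ((f(v := y, u := x)) (snd e))) = A x y * ?g x * ?h y" for x y
    proof -
      have "(\<Prod>e\<in>E. A ((f(v := y, u := x)) (fst e)) ((f(v := y, u := x)) (snd e))) =
        A x y * (\<Prod>e\<in>D. A ((f(v := y, u := x)) (fst e)) ((f(v := y, u := x)) (snd e)))"
        unfolding D_def using prod.remove[OF finE uv, of "\<lambda>e. A ((f(v := y, u := x)) (fst e)) ((f(v := y, u := x)) (snd e))"] simple by simp
      also have "(\<Prod>e\<in>D. A ((f(v := y, u := x)) (fst e)) ((f(v := y, u := x)) (snd e))) =
        (\<Prod>e\<in>E1. A ((f(v := y, u := x)) (fst e)) ((f(v := y, u := x)) (snd e))) *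
        (\<Prod>e\<in>E2. A ((f(v := y, u := x)) (fst e)) ((f(v := y, u := x)) (snd e)))"
        unfolding D(2) using D by (intro prod.union_disjoint) auto
      also have "(\<Prod>e\<in>E1. A ((f(v := y, u := x)) (fst e)) ((f(v := y, u := x)) (snd e))) = ?g x"
        using simple by (intro prod.cong refl) (auto simp: E1_def D_def)
      also have "(\<Prod>e\<in>E2. A ((f(v := y, u := x)) (fst e)) ((f(v := y, u := x)) (snd e))) = ?h y"
        by (intro prod.cong refl) (auto simp: E2_def)
      finally show ?thesis by (simp only: mult.assoc)
    qed
    then show ?thesis using root_bound[of ?g ?h, OF abs_prod abs_prod] by (simp only:)
  qed
  have "(\<Sum>f\<in>I \<rightarrow>\<^sub>E V. \<Prod>e\<in>E. A (f (fst e)) (f (snd e))) =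
    (\<Sum>x\<in>V. \<Sum>y\<in>V. \<Sum>f\<in>J \<rightarrow>\<^sub>E V. \<Prod>e\<in>E. A ((f(v := y, u := x)) (fst e)) ((f(v := y, u := x)) (snd e)))"
    using IJ by (simp only: sum_PiE_insert not_False_eq_True)
  also have "\<dots> = (\<Sum>x\<in>V. \<Sum>f\<in>J \<rightarrow>\<^sub>E V. \<Sum>y\<in>V. \<Prod>e\<in>E. A ((f(v := y, u := x)) (fst e)) ((f(v := y, u := x)) (snd e)))"
    by (intro sum.cong refl sum.swap)
  also have "\<dots> = (\<Sum>f\<in>J \<rightarrow>\<^sub>E V. \<Sum>x\<in>V. \<Sum>y\<in>V. \<Prod>e\<in>E. A ((f(v := y, u := x)) (fst e)) ((f(v := y, u := x)) (snd e)))"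
    by (rule sum.swap)
  also have "\<bar>\<dots>\<bar> \<le> (\<Sum>f\<in>J \<rightarrow>\<^sub>E V. ?n * root 4 ?C)"
    by (rule order.trans[OF sum_abs sum_mono]) (rule inner)
  also have "\<dots> = ?n ^ (card I - 1) * root 4 ?C"
    unfolding cardI using I by (simp add: card_PiE J_def)
  finally show ?thesis .
qed

text \<open>Expanded over the subsets of \<open>E\<close>, the empty subset gives the main term and
  every other subset contains an arc and is bounded by \<open>pattern_sum_le\<close>.\<close>

lemma pattern_product_le:
  assumes I: "finite I" and E: "E \<subseteq> I \<times> I" and simple: "\<And>u v. (u, v) \<in> E \<Longrightarrow> u \<noteq> v \<and> (v, u) \<notin> E"
  shows "\<bar>(\<Sum>f\<in>I \<rightarrow>\<^sub>E V. \<Prod>e\<in>E. 1 + A (f (fst e)) (f (snd e))) - real (card V) ^ card I\<bar> \<le>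
    2 ^ card E * (real (card V) ^ (card I - 1) * root 4 (\<Sum>a\<in>V. \<Sum>b\<in>V. (codeg a b)\<^sup>2))"
proof -
  let ?S = "\<lambda>H. \<Sum>f\<in>I \<rightarrow>\<^sub>E V. \<Prod>e\<in>H. A (f (fst e)) (f (snd e))"
  let ?b = "real (card V) ^ (card I - 1) * root 4 (\<Sum>a\<in>V. \<Sum>b\<in>V. (codeg a b)\<^sup>2)"
  have b: "0 \<le> ?b" by (simp add: sum_nonneg)
  have finE: "finite E" using E I finite_subset by blast
  have "(\<Sum>f\<in>I \<rightarrow>\<^sub>E V. \<Prod>e\<in>E. 1 + A (f (fst e)) (f (snd e))) = (\<Sum>H\<in>Pow E. ?S H)"
    unfolding add.commute[of 1] prod_add[OF finE] by (subst sum.swap) simp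
  also have "\<dots> = ?S {} + (\<Sum>H\<in>Pow E - {{}}. ?S H)"
    using finE by (intro sum.remove) auto
  also have "?S {} = real (card V) ^ card I" using I by (simp add: card_PiE)
  finally have "\<bar>(\<Sum>f\<in>I \<rightarrow>\<^sub>E V. \<Prod>e\<in>E. 1 + A (f (fst e)) (f (snd e))) - real (card V) ^ card I\<bar> =
    \<bar>\<Sum>H\<in>Pow E - {{}}. ?S H\<bar>" by simp
  also have "\<dots> \<le> (\<Sum>H\<in>Pow E - {{}}. ?b)"
  proof (rule order.trans[OF sum_abs sum_mono])
    fix H assume "H \<in> Pow E - {{}}"
    then obtain u v where "(u, v) \<in> H" "H \<subseteq> E" by auto
    then show "\<bar>?S H\<bar> \<le> ?b"
      using simple[of u v] E by (intro pattern_sum_le[OF I, of u v]) auto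
  qed
  also have "\<dots> \<le> (\<Sum>H\<in>Pow E. ?b)"
    using finE b by (intro sum_mono2) auto
  finally show ?thesis using finE by (simp add: card_Pow)
qed

end

section \<open>Embeddings and densities\<close>

definition embeddings :: "'a pair_pre_digraph \<Rightarrow> 'b pair_pre_digraph \<Rightarrow> ('a \<Rightarrow> 'b) set" where
  "embeddings S T = {f \<in> pverts S \<rightarrow>\<^sub>E pverts T. inj_on f (pverts S) \<and>
     (\<forall>(u, v)\<in>parcs S. (f u, f v) \<in> parcs T)}"

lemma embeddingsI:
  assumes "f \<in> pverts S \<rightarrow>\<^sub>E pverts T" "inj_on f (pverts S)"
    "\<And>u v. (u, v) \<in> parcs S \<Longrightarrow> (f u, f v) \<in> parcs T"
  shows "f \<in> embeddings S T"
  using assms by (auto simp: embeddings_def)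

lemma tournament_arcD:
  assumes "tournament T" "(u, v) \<in> parcs T"
  shows "u \<in> pverts T" "v \<in> pverts T" "u \<noteq> v" "(v, u) \<notin> parcs T"
proof -
  interpret tournament T by fact
  show 1: "u \<in> pverts T" "v \<in> pverts T" using assms(2) in_arcsD1 in_arcsD2 by auto
  show 2: "u \<noteq> v" using assms(2) pair_no_loops by fastforce
  show "(v, u) \<notin> parcs T" using assms(2) 1 2 exactly_one_arc by blast
qed

lemma tournament_arc_cases:
  assumes "tournament T" "u \<in> pverts T" "v \<in> pverts T" "u \<noteq> v"
  shows "(u, v) \<in> parcs T \<or> (v, u) \<in> parcs T"
  using assms tournament.exactly_one_arc by fast

lemma finite_pverts: "tournament T \<Longrightarrow> finite (pverts T)"
  using pair_fin_digraph.pair_finite_verts pair_digraph.axioms(1) tournament.axioms(1) by blast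

text \<open>Arcs are also reflected: otherwise the opposite arc of \<open>S\<close> would be mapped
  to the opposite arc of \<open>T\<close>.\<close>

lemma embedding_arc_iff:
  assumes "tournament S" "tournament T" "f \<in> embeddings S T" "u \<in> pverts S" "v \<in> pverts S"
  shows "(f u, f v) \<in> parcs T \<longleftrightarrow> (u, v) \<in> parcs S"
proof
  assume *: "(f u, f v) \<in> parcs T"
  then have "u \<noteq> v" using tournament_arcD[OF assms(2)] by blast
  moreover have "(v, u) \<notin> parcs S"
    using * assms(3) tournament_arcD(4)[OF assms(2)] by (auto simp: embeddings_def)
  ultimately show "(u, v) \<in> parcs S" using tournament_arc_cases assms by metis
qed (use assms in \<open>auto simp: embeddings_def\<close>)

text \<open>Library isomorphisms carry separate maps for vertices, arcs, tails and heads; counting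
  is easier with embeddings. The isomorphism runs from the induced subgraph to \<open>S\<close>, so
  the embedding is the inverse of its vertex map.\<close>

lemma iso_induced_iff:
  fixes S :: "'a pair_pre_digraph" and T :: "'b pair_pre_digraph"
  assumes S: "tournament S" and T: "tournament T" and X: "X \<subseteq> pverts T"
  shows "digraph_iso (with_proj T \<restriction> X) (with_proj S) \<longleftrightarrow> (\<exists>f\<in>embeddings S T. f ` pverts S = X)"
proof
  interpret T: tournament T by fact
  interpret S: tournament S by fact
  have arcs: "arcs (with_proj T \<restriction> X) = {e \<in> parcs T. fst e \<in> X \<and> snd e \<in> X}"
    by (auto simp: induce_subgraph_def)
  {
    assume "digraph_iso (with_proj T \<restriction> X) (with_proj S)"
    then obtain h where h: "pre_digraph.digraph_isomorphism (with_proj T \<restriction> X) h"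
      and eq: "with_proj S = app_iso h (with_proj T \<restriction> X)"
      by (auto simp: digraph_iso_def)
    define g where "g = iso_verts h"
    have inj: "inj_on g X"
      using h by (auto simp: pre_digraph.digraph_isomorphism_def g_def)
    have verts: "pverts S = g ` X"
      using arg_cong[OF eq, of verts] by (simp add: g_def)
    \<comment> \<open>Since the image is \<open>with_proj S\<close>, tails and heads are projections
      there, so the arc map is determined by the vertex map.\<close>
    have tail: "iso_tail h = fst" and head: "iso_head h = snd"
      using arg_cong[OF eq, of tail] arg_cong[OF eq, of head] by simp_all
    have "iso_arcs h e = (g (fst e), g (snd e))" if "e \<in> parcs T" "fst e \<in> X" "snd e \<in> X" for e
      using h that arcs
      by (cases e) (auto simp: pre_digraph.digraph_isomorphism_def tail head g_def intro!: prod_eqI)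
    then have parcs: "parcs S = (\<lambda>e. (g (fst e), g (snd e))) ` {e \<in> parcs T. fst e \<in> X \<and> snd e \<in> X}"
      using arg_cong[OF eq, of arcs] arcs by simp
    define f where "f = restrict (inv_into X g) (pverts S)"
    have f: "f (g x) = x" if "x \<in> X" for x
      using that inj by (simp add: f_def verts)
    have "f \<in> pverts S \<rightarrow>\<^sub>E pverts T"
      using X f by (auto simp: verts f_def)
    moreover have "inj_on f (pverts S)"
      using f by (auto simp: verts intro!: inj_onI)
    moreover have "(f u, f v) \<in> parcs T" if "(u, v) \<in> parcs S" for u v
      using that f by (auto simp: parcs)
    ultimately have "f \<in> embeddings S T"
      by (rule embeddingsI)
    moreover have "f ` pverts S = X"
      using f by (force simp: verts image_image)
    ultimately show "\<exists>f\<in>embeddings S T. f ` pverts S = X" by blast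
  }
  {
    assume "\<exists>f\<in>embeddings S T. f ` pverts S = X"
    then obtain f where f: "f \<in> embeddings S T" and image: "f ` pverts S = X" by blast
    define g where "g = inv_into (pverts S) f"
    have inj: "inj_on f (pverts S)" using f by (simp add: embeddings_def)
    have gf: "g (f u) = u" if "u \<in> pverts S" for u using inj that by (simp add: g_def)
    define h where "h = \<lparr>iso_verts = g, iso_arcs = (\<lambda>e. (g (fst e), g (snd e))), iso_head = snd, iso_tail = fst\<rparr>"
    have inj_g: "inj_on g X" using gf by (auto simp: image[symmetric] intro!: inj_onI)
    have "pre_digraph.digraph_isomorphism (with_proj T \<restriction> X) h"
      unfolding pre_digraph.digraph_isomorphism_def
    proof (intro conjI)
      show "wf_digraph (with_proj T \<restriction> X)"
        using X by (intro T.wellformed_induce_subgraph)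
      show "inj_on (iso_arcs h) (arcs (with_proj T \<restriction> X))"
        using inj_g unfolding arcs h_def by (auto simp: inj_on_def)
    qed (use inj_g in \<open>auto simp: h_def\<close>)
    moreover have "with_proj S = app_iso h (with_proj T \<restriction> X)"
    proof -
      have "g ` X = pverts S" using gf by (force simp: image[symmetric] image_image)
      moreover have "(\<lambda>e. (g (fst e), g (snd e))) ` {e \<in> parcs T. fst e \<in> X \<and> snd e \<in> X} = parcs S" (is "?L = _")
      proof
        show "?L \<subseteq> parcs S"
        proof clarsimp
          fix x y assume "(x, y) \<in> parcs T" "x \<in> X" "y \<in> X"
          then obtain u v where "u \<in> pverts S" "v \<in> pverts S" "x = f u" "y = f v" "(f u, f v) \<in> parcs T"
            by (auto simp: image[symmetric])
          then show "(g x, g y) \<in> parcs S" using embedding_arc_iff[OF S T f] gf by simp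
        qed
        show "parcs S \<subseteq> ?L"
        proof clarify
          fix u v assume uv: "(u, v) \<in> parcs S"
          then have "u \<in> pverts S" "v \<in> pverts S" using tournament_arcD[OF S] by auto
          then have "(u, v) = (g (f u), g (f v))" "(f u, f v) \<in> parcs T" "f u \<in> X" "f v \<in> X"
            using uv gf f image by (auto simp: embeddings_def)
          then show "(u, v) \<in> ?L" by (intro image_eqI[of _ _ "(f u, f v)"]) auto
        qed
      qed
      ultimately show ?thesis unfolding app_iso_def with_proj_def[of S] arcs by (simp add: h_def)
    qed
    ultimately show "digraph_iso (with_proj T \<restriction> X) (with_proj S)" by (auto simp: digraph_iso_def)
  }
qed

lemma finite_embeddings: "tournament S \<Longrightarrow> tournament T \<Longrightarrow> finite (embeddings S T)"
  unfolding embeddings_def by (intro finite_subset[OF _ finite_PiE[of "pverts S" "\<lambda>_. pverts T"]]) (auto simp: finite_pverts)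

text \<open>Two embeddings with the same image differ by a unique automorphism. Automorphisms are
  total and fix all non-vertices, embeddings are extensional; this explains the
  \<open>restrict\<close> in one direction and the case distinction in the other.\<close>

lemma card_embeddings_onto:
  assumes S: "tournament S" and T: "tournament T" and f: "f \<in> embeddings S T"
  shows "card {g \<in> embeddings S T. g ` pverts S = f ` pverts S} = card (Aut S)"
proof -
  let ?V = "pverts S"
  have inj: "inj_on f ?V" and ext: "f \<in> ?V \<rightarrow>\<^sub>E pverts T" using f by (auto simp: embeddings_def)
  have "bij_betw (\<lambda>s. restrict (f \<circ> s) ?V) (Aut S) {g \<in> embeddings S T. g ` ?V = f ` ?V}"
  proof (rule bij_betw_byWitness[where f' = "\<lambda>g x. if x \<in> ?V then inv_into ?V f (g x) else x"])
    show "\<forall>s\<in>Aut S. (\<lambda>x. if x \<in> ?V then inv_into ?V f (restrict (f \<circ> s) ?V x) else x) = s"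
    proof
      fix s assume "s \<in> Aut S"
      then have s: "s permutes ?V" by (simp add: Aut_def)
      show "(\<lambda>x. if x \<in> ?V then inv_into ?V f (restrict (f \<circ> s) ?V x) else x) = s"
        using s inj by (auto simp: fun_eq_iff permutes_in_image permutes_not_in)
    qed
    show "\<forall>g\<in>{g \<in> embeddings S T. g ` ?V = f ` ?V}. restrict (f \<circ> (\<lambda>x. if x \<in> ?V then inv_into ?V f (g x) else x)) ?V = g"
    proof clarify
      fix g assume g: "g \<in> embeddings S T" "g ` ?V = f ` ?V"
      have "f (inv_into ?V f (g x)) = g x" if "x \<in> ?V" for x
        using g(2) that by (intro f_inv_into_f) blast
      then show "restrict (f \<circ> (\<lambda>x. if x \<in> ?V then inv_into ?V f (g x) else x)) ?V = g"
        using g(1) by (auto simp: fun_eq_iff embeddings_def PiE_def extensional_def)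
    qed
    show "(\<lambda>s. restrict (f \<circ> s) ?V) ` Aut S \<subseteq> {g \<in> embeddings S T. g ` ?V = f ` ?V}"
    proof clarify
      fix s assume s: "s \<in> Aut S"
      then have perm: "s permutes ?V" and arc: "\<And>u v. u \<in> ?V \<Longrightarrow> v \<in> ?V \<Longrightarrow> (s u, s v) \<in> parcs S \<longleftrightarrow> (u, v) \<in> parcs S"
        by (auto simp: Aut_def)
      have sV: "s ` ?V = ?V" "inj_on s ?V" "\<And>u. u \<in> ?V \<Longrightarrow> s u \<in> ?V"
        using perm by (auto simp: permutes_image permutes_inj_on permutes_in_image)
      have "inj_on (restrict (f \<circ> s) ?V) ?V"
        using inj sV by (simp add: inj_on_restrict_eq comp_inj_on)
      moreover have "(restrict (f \<circ> s) ?V) ` ?V = f ` ?V"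
        using sV(1) by (metis image_comp image_restrict_eq)
      moreover have "(restrict (f \<circ> s) ?V u, restrict (f \<circ> s) ?V v) \<in> parcs T" if "(u, v) \<in> parcs S" for u v
      proof -
        have uv: "u \<in> ?V" "v \<in> ?V" using tournament_arcD[OF S that] by auto
        then have "(s u, s v) \<in> parcs S" using arc that by simp
        then show ?thesis using f uv by (auto simp: embeddings_def)
      qed
      moreover have "restrict (f \<circ> s) ?V \<in> ?V \<rightarrow>\<^sub>E pverts T"
        using ext sV(3) by auto
      ultimately show "restrict (f \<circ> s) ?V \<in> embeddings S T \<and> restrict (f \<circ> s) ?V ` ?V = f ` ?V"
        by (blast intro: embeddingsI)
    qed
    show "(\<lambda>g x. if x \<in> ?V then inv_into ?V f (g x) else x) ` {g \<in> embeddings S T. g ` ?V = f ` ?V} \<subseteq> Aut S"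
    proof clarify
      fix g assume g: "g \<in> embeddings S T" "g ` ?V = f ` ?V"
      let ?s = "\<lambda>x. if x \<in> ?V then inv_into ?V f (g x) else x"
      have mem: "inv_into ?V f (g x) \<in> ?V" and eq: "f (inv_into ?V f (g x)) = g x" if "x \<in> ?V" for x
        using g(2) that by (auto intro!: inv_into_into f_inv_into_f)
      have "inj_on ?s ?V"
      proof (rule inj_onI)
        fix x y assume xy: "x \<in> ?V" "y \<in> ?V" "?s x = ?s y"
        then have "g x = g y" using eq by metis
        then show "x = y" using g(1) xy by (auto simp: embeddings_def inj_on_def)
      qed
      then have "bij_betw ?s ?V ?V"
        unfolding bij_betw_def using mem endo_inj_surj[OF finite_pverts[OF S], of ?s] by (simp add: image_subset_iff)
      then have "?s permutes ?V" by (intro bij_imp_permutes) auto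
      moreover have "(?s u, ?s v) \<in> parcs S \<longleftrightarrow> (u, v) \<in> parcs S" if "u \<in> ?V" "v \<in> ?V" for u v
        using embedding_arc_iff[OF S T f mem[OF that(1)] mem[OF that(2)]] embedding_arc_iff[OF S T g(1) that] that eq by simp
      ultimately show "?s \<in> Aut S" by (auto simp: Aut_def)
    qed
  qed
  then show ?thesis by (simp add: bij_betw_same_card)
qed

lemma card_embeddings:
  fixes S :: "'a pair_pre_digraph" and T :: "'b pair_pre_digraph"
  assumes S: "tournament S" and T: "tournament T"
  shows "card (embeddings S T) = card (Aut S) * card {X. X \<subseteq> pverts T \<and> card X = card (pverts S) \<and>
    digraph_iso (with_proj T \<restriction> X) (with_proj S)}"
proof -
  let ?X = "{X. X \<subseteq> pverts T \<and> card X = card (pverts S) \<and> digraph_iso (with_proj T \<restriction> X) (with_proj S)}"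
  have fin: "finite ?X" using finite_pverts[OF T] by (rule finite_subset[rotated, OF finite_Pow_iff[THEN iffD2]]) auto
  have image: "?X = (\<lambda>f. f ` pverts S) ` embeddings S T"
  proof (intro equalityI subsetI)
    fix X assume "X \<in> ?X"
    then show "X \<in> (\<lambda>f. f ` pverts S) ` embeddings S T" using iso_induced_iff[OF S T] by auto
  next
    fix X assume "X \<in> (\<lambda>f. f ` pverts S) ` embeddings S T"
    then obtain f where f: "f \<in> embeddings S T" "X = f ` pverts S" by auto
    then have "X \<subseteq> pverts T" "card X = card (pverts S)" by (auto simp: embeddings_def card_image)
    then show "X \<in> ?X" using iso_induced_iff[OF S T, of X] f by auto
  qed
  have "embeddings S T = (\<Union>X\<in>?X. {g \<in> embeddings S T. g ` pverts S = X})"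
    unfolding image by auto
  then have "card (embeddings S T) = card (\<Union>X\<in>?X. {g \<in> embeddings S T. g ` pverts S = X})" by simp
  also have "\<dots> = (\<Sum>X\<in>?X. card {g \<in> embeddings S T. g ` pverts S = X})"
    using fin finite_embeddings[OF S T] by (intro card_UN_disjoint) auto
  also have "\<dots> = (\<Sum>X\<in>?X. card (Aut S))"
  proof (rule sum.cong[OF refl])
    fix X assume "X \<in> ?X"
    then obtain f where "f \<in> embeddings S T" "X = f ` pverts S" unfolding image by auto
    then show "card {g \<in> embeddings S T. g ` pverts S = X} = card (Aut S)"
      using card_embeddings_onto[OF S T] by simp
  qed
  finally show ?thesis by simp
qed

lemma card_Aut_pos:
  assumes "tournament S"
  shows "card (Aut S) > 0"
proof -
  have "id \<in> Aut S" by (auto simp: Aut_def permutes_id)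
  moreover have "finite (Aut S)"
    using finite_permutations[OF finite_pverts[OF assms]] by (rule finite_subset[rotated]) (auto simp: Aut_def)
  ultimately show ?thesis by (auto simp: card_gt_0_iff)
qed

lemma density_eq_embeddings:
  assumes "tournament S" "tournament T"
  shows "density S T = real (card (embeddings S T)) / (real (card (Aut S)) * real (card (pverts T) choose card (pverts S)))"
  using card_Aut_pos[OF assms(1)] unfolding density_def card_embeddings[OF assms] by simp

section \<open>From embeddings to products over arcs\<close>

definition orientation :: "'a pair_pre_digraph \<Rightarrow> 'a \<Rightarrow> 'a \<Rightarrow> real" where
  "orientation T x y = of_bool ((x, y) \<in> parcs T) - of_bool ((y, x) \<in> parcs T)"

lemma skew_kernel_orientation: "tournament T \<Longrightarrow> skew_kernel (pverts T) (orientation T)"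
  by unfold_locales (auto simp: orientation_def finite_pverts)

lemma finite_parcs: "tournament T \<Longrightarrow> finite (parcs T)"
  using pair_fin_digraph.pair_finite_arcs pair_digraph.axioms(1) tournament.axioms(1) by blast

lemma card_parcs:
  assumes "tournament T"
  shows "card (parcs T) = card (pverts T) choose 2"
proof -
  have "bij_betw (\<lambda>(u, v). {u, v}) (parcs T) {X. X \<subseteq> pverts T \<and> card X = 2}"
    unfolding bij_betw_def
  proof
    show "inj_on (\<lambda>(u, v). {u, v}) (parcs T)"
      using tournament_arcD(4)[OF assms] by (auto simp: inj_on_def doubleton_eq_iff)
    show "(\<lambda>(u, v). {u, v}) ` parcs T = {X. X \<subseteq> pverts T \<and> card X = 2}"
    proof (intro equalityI subsetI)
      fix X assume "X \<in> {X. X \<subseteq> pverts T \<and> card X = 2}"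
      then obtain u v where X: "X = {u, v}" "u \<noteq> v" "u \<in> pverts T" "v \<in> pverts T"
        by (auto simp: card_2_iff)
      then consider "(u, v) \<in> parcs T" | "(v, u) \<in> parcs T" using tournament_arc_cases[OF assms] by blast
      then show "X \<in> (\<lambda>(u, v). {u, v}) ` parcs T"
        using X by cases (force intro: image_eqI)+
    qed (use tournament_arcD[OF assms] in auto)
  qed
  then show ?thesis
    by (simp add: bij_betw_same_card n_subsets finite_pverts[OF assms])
qed

lemma orientation_product:
  assumes S: "tournament S" and T: "tournament T"
    and f: "f \<in> pverts S \<rightarrow>\<^sub>E pverts T" "inj_on f (pverts S)"
  shows "(\<Prod>e\<in>parcs S. 1 + orientation T (f (fst e)) (f (snd e))) =
    (if f \<in> embeddings S T then 2 ^ card (parcs S) else 0)"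
proof -
  have val: "1 + orientation T (f u) (f v) = (if (f u, f v) \<in> parcs T then 2 else 0)"
    if "(u, v) \<in> parcs S" for u v
  proof -
    have "u \<in> pverts S" "v \<in> pverts S" "u \<noteq> v" using tournament_arcD[OF S that] by auto
    then have "f u \<in> pverts T" "f v \<in> pverts T" "f u \<noteq> f v" using f by (auto dest: inj_onD)
    then show ?thesis
      using tournament_arc_cases[OF T, of "f u" "f v"] tournament_arcD(4)[OF T] by (auto simp: orientation_def)
  qed
  show ?thesis
  proof (cases "f \<in> embeddings S T")
    case True
    then have "(\<Prod>e\<in>parcs S. 1 + orientation T (f (fst e)) (f (snd e))) = (\<Prod>e\<in>parcs S. 2)"
      using val by (intro prod.cong) (auto simp: embeddings_def)
    then show ?thesis using True by simp
  next
    case False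
    then obtain u v where "(u, v) \<in> parcs S" "(f u, f v) \<notin> parcs T"
      using f embeddingsI by blast
    then show ?thesis using False val finite_parcs[OF S] by (auto intro!: prod_zero bexI[of _ "(u, v)"])
  qed
qed

lemma orientation_product_bounds:
  "0 \<le> (\<Prod>e\<in>E. 1 + orientation T (f (fst e)) (f (snd e)))"
  "(\<Prod>e\<in>E. 1 + orientation T (f (fst e)) (f (snd e))) \<le> 2 ^ card E"
proof -
  have "0 \<le> 1 + orientation T x y" "1 + orientation T x y \<le> 2" for x y
    by (auto simp: orientation_def)
  then show "0 \<le> (\<Prod>e\<in>E. 1 + orientation T (f (fst e)) (f (snd e)))"
    "(\<Prod>e\<in>E. 1 + orientation T (f (fst e)) (f (snd e))) \<le> 2 ^ card E"
    using prod_mono[of E "\<lambda>e. 1 + orientation T (f (fst e)) (f (snd e))" "\<lambda>_. 2"]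
    by (auto intro: prod_nonneg)
qed

lemma card_injections:
  assumes "finite I" "finite V"
  shows "card {f \<in> I \<rightarrow>\<^sub>E V. inj_on f I} = fact (card I) * (card V choose card I)"
proof (cases "card I \<le> card V")
  case True
  have "real (\<Prod>i = 0..<card I. card V - i) = (\<Prod>i = 0..<card I. real (card V) - real i)"
    unfolding of_nat_prod using True by (intro prod.cong) (auto simp: of_nat_diff)
  also have "\<dots> = real (fact (card I) * (card V choose card I))"
    by (simp add: binomial_gbinomial gbinomial_mult_fact)
  finally have "(\<Prod>i = 0..<card I. card V - i) = fact (card I) * (card V choose card I)"
    by (simp only: of_nat_eq_iff)
  then show ?thesis
    using card_inj_on_subset_funcset[OF assms subset_refl] by simp
next
  case False
  then have empty: "{f \<in> I \<rightarrow>\<^sub>E V. inj_on f I} = {}"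
    using assms card_inj_on_le[of _ I V] by (auto simp: image_subset_iff PiE_iff)
  show ?thesis unfolding empty using False by (simp add: binomial_eq_0)
qed

text \<open>An injective map contributes \<open>2 ^ e\<close> if it is an embedding and 0 otherwise,
  any other map something between 0 and \<open>2 ^ e\<close>. The last term counts the non-injective
  maps.\<close>

lemma sum_orientation_product_bounds:
  fixes S :: "'a pair_pre_digraph" and T :: "'b pair_pre_digraph"
  assumes S: "tournament S" and T: "tournament T"
  defines "k \<equiv> card (pverts S)" and "n \<equiv> card (pverts T)" and "e \<equiv> card (parcs S)"
    and "s \<equiv> (\<Sum>f\<in>pverts S \<rightarrow>\<^sub>E pverts T. \<Prod>e\<in>parcs S. 1 + orientation T (f (fst e)) (f (snd e)))"
  shows "2 ^ e * real (card (embeddings S T)) \<le> s"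
    "s \<le> 2 ^ e * real (card (embeddings S T)) + 2 ^ e * (real n ^ k - fact k * real (n choose k))"
proof -
  let ?P = "\<lambda>f. \<Prod>e\<in>parcs S. 1 + orientation T (f (fst e)) (f (snd e))"
  let ?F = "pverts S \<rightarrow>\<^sub>E pverts T"
  let ?J = "{f \<in> ?F. inj_on f (pverts S)}"
  have fin: "finite (pverts S)" "finite (pverts T)" "finite ?F" "finite ?J"
    using finite_pverts[OF S] finite_pverts[OF T] finite_PiE[of "pverts S" "\<lambda>_. pverts T"] by simp_all
  have "s = sum ?P ?J + sum ?P (?F - ?J)"
    unfolding s_def using fin by (subst add.commute, intro sum.subset_diff) auto
  also have "sum ?P ?J = (\<Sum>f\<in>?J. if f \<in> embeddings S T then 2 ^ e else 0)"
    unfolding e_def using orientation_product[OF S T] by (intro sum.cong) auto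
  also have "\<dots> = 2 ^ e * real (card (embeddings S T))"
  proof -
    have "?J \<inter> {f. f \<in> embeddings S T} = embeddings S T" by (auto simp: embeddings_def)
    then show ?thesis using fin by (simp add: sum.If_cases)
  qed
  finally have s: "s = 2 ^ e * real (card (embeddings S T)) + sum ?P (?F - ?J)" .
  have "0 \<le> sum ?P (?F - ?J)" by (intro sum_nonneg orientation_product_bounds)
  then show "2 ^ e * real (card (embeddings S T)) \<le> s" using s by simp
  have "sum ?P (?F - ?J) \<le> (\<Sum>f\<in>?F - ?J. 2 ^ e)"
    unfolding e_def by (intro sum_mono orientation_product_bounds)
  also have "\<dots> = 2 ^ e * (real (card ?F) - real (card ?J))"
    using fin by (simp add: card_Diff_subset of_nat_diff card_mono)
  also have "\<dots> = 2 ^ e * (real n ^ k - fact k * real (n choose k))"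
    using card_injections[OF fin(1,2)] fin(1) by (simp add: card_PiE k_def n_def)
  finally show "s \<le> 2 ^ e * real (card (embeddings S T)) + 2 ^ e * (real n ^ k - fact k * real (n choose k))"
    using s by simp
qed

text \<open>The signed number of closed walks of length 4, outside the locale so that it can be
  followed along a sequence. Being of lower order than \<open>n ^ 4\<close> is the condition that
  links the density of \<open>T58\<close> to quasi-randomness.\<close>

definition codegree_energy :: "'a pair_pre_digraph \<Rightarrow> real" where
  "codegree_energy T = (\<Sum>a\<in>pverts T. \<Sum>b\<in>pverts T. (\<Sum>t\<in>pverts T. orientation T a t * orientation T b t)\<^sup>2)"

lemma codegree_energy_nonneg: "codegree_energy T \<ge> 0"
  by (simp add: codegree_energy_def sum_nonneg)

lemma embeddings_approx:
  fixes S :: "'a pair_pre_digraph" and T :: "'b pair_pre_digraph"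
  assumes S: "tournament S" and T: "tournament T"
  defines "k \<equiv> card (pverts S)" and "n \<equiv> card (pverts T)" and "e \<equiv> card (parcs S)"
  shows "\<bar>2 ^ e * real (card (embeddings S T)) - real n ^ k\<bar> \<le>
    2 ^ e * (real n ^ (k - 1) * root 4 (codegree_energy T)) + 2 ^ e * (real n ^ k - fact k * real (n choose k))"
proof -
  interpret skew_kernel "pverts T" "orientation T" by (rule skew_kernel_orientation[OF T])
  have "\<bar>(\<Sum>f\<in>pverts S \<rightarrow>\<^sub>E pverts T. \<Prod>e\<in>parcs S. 1 + orientation T (f (fst e)) (f (snd e))) - real n ^ k\<bar> \<le>
    2 ^ e * (real n ^ (k - 1) * root 4 (codegree_energy T))"
    unfolding n_def k_def e_def codegree_energy_def codeg_def[symmetric]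
    using tournament_arcD[OF S] by (intro pattern_product_le finite_pverts[OF S]) auto
  then show ?thesis
    using sum_orientation_product_bounds[OF S T] unfolding k_def n_def e_def by linarith
qed

section \<open>The tournament \<open>T58\<close>\<close>

lemma tournament_T58: "tournament T58"
proof unfold_locales
  fix u v assume "u \<in> pverts T58" "v \<in> pverts T58" "u \<noteq> v"
  moreover have "pverts T58 = {1,2,3,4,5}" by (auto simp: T58_def)
  ultimately have "u \<in> {1,2,3,4,5}" "v \<in> {1,2,3,4,5}" "u \<noteq> v" by simp_all
  then show "((u, v) \<in> parcs T58) \<noteq> ((v, u) \<in> parcs T58)"
    by (elim insertE emptyE; simp add: T58_def)
qed (auto simp: T58_def)

text \<open>Only the identity preserves the ten arcs. Each arc condition follows the quantifier of
  its later end, so that a failing partial assignment need not be extended.\<close>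

lemma arcs58_rigid:
  "\<forall>a\<in>set [1..<6]. \<forall>b\<in>set [1..<6]. (a, b) \<in> set arcs58 \<longrightarrow>
     (\<forall>c\<in>set [1..<6]. (a, c) \<in> set arcs58 \<longrightarrow> (b, c) \<in> set arcs58 \<longrightarrow>
     (\<forall>d\<in>set [1..<6]. (a, d) \<in> set arcs58 \<longrightarrow> (b, d) \<in> set arcs58 \<longrightarrow> (c, d) \<in> set arcs58 \<longrightarrow>
     (\<forall>e\<in>set [1..<6]. (b, e) \<in> set arcs58 \<longrightarrow> (d, e) \<in> set arcs58 \<longrightarrow> (e, a) \<in> set arcs58 \<longrightarrow>
        (e, c) \<in> set arcs58 \<longrightarrow> a = 1 \<and> b = 2 \<and> c = 3 \<and> d = 4 \<and> e = 5)))"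
  by code_simp

lemma Aut_T58: "Aut T58 = {id}"
proof
  show "{id} \<subseteq> Aut T58" by (auto simp: Aut_def permutes_id)
  show "Aut T58 \<subseteq> {id}"
  proof
    fix f assume "f \<in> Aut T58"
    then have "f permutes pverts T58" and arc: "\<And>u v. (u, v) \<in> parcs T58 \<Longrightarrow> (f u, f v) \<in> parcs T58"
      using tournament_arcD[OF tournament_T58] by (auto simp: Aut_def)
    then have f: "f permutes {1..5}" by (simp add: T58_def)
    have A: "(f u, f v) \<in> set arcs58" if "(u, v) \<in> set arcs58" for u v
      using arc[of u v] that by (simp add: T58_def arcs58_def)
    have range: "f x \<in> set [1..<6]" if "x \<in> {1..5}" for x
      using f that permutes_in_image[OF f, of x] by auto
    have "f 1 = 1 \<and> f 2 = 2 \<and> f 3 = 3 \<and> f 4 = 4 \<and> f 5 = 5"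
      by (rule arcs58_rigid[rule_format]) (intro range A; simp add: arcs58_def)+
    then have "f x = x" for x
    proof (cases "x \<in> {1..5}")
      case True
      then have "x \<in> {1,2,3,4,5}" by auto
      then show ?thesis using \<open>f 1 = 1 \<and> f 2 = 2 \<and> f 3 = 3 \<and> f 4 = 4 \<and> f 5 = 5\<close> by auto
    qed (use f in \<open>auto simp: permutes_not_in\<close>)
    then show "f \<in> {id}" by auto
  qed
qed

lemma card_parcs_T58: "card (parcs T58) = 10" and card_pverts_T58: "card (pverts T58) = 5"
  by (simp_all add: T58_def)

text \<open>The value is \<open>5! / 2 ^ 10\<close>, since \<open>T58\<close> has no nontrivial
  automorphism.\<close>

lemma phi_qr_T58: "phi_qr T58 = 15 / 128"
  by (simp add: phi_qr_def card_pverts_T58 Aut_T58 fact_numeral choose_two)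

text \<open>Without the energy term this is the upper bound on the density; with it, a density close
  to the bound forces a small energy.\<close>

lemma density_T58_le:
  assumes T: "tournament T"
  defines "n \<equiv> card (pverts T)"
  shows "1024 * (density T58 T * real (n choose 5)) \<le> real n ^ 5 - real n / 32 * codegree_energy T"
proof -
  interpret skew_kernel "pverts T" "orientation T" by (rule skew_kernel_orientation[OF T])
  have set: "parcs T58 = set arcs58" and dist: "distinct arcs58" and verts: "pverts T58 = {1..5}"
    by (auto simp: T58_def arcs58_def)
  \<comment> \<open>With fewer than five vertices the binomial coefficient is 0, and so is the
    left-hand side.\<close>
  have "density T58 T * real (n choose 5) \<le> real (card (embeddings T58 T))"
    unfolding density_eq_embeddings[OF tournament_T58 T] by (simp add: Aut_T58 card_pverts_T58 n_def)
  then have "1024 * (density T58 T * real (n choose 5)) \<le> 2 ^ 10 * real (card (embeddings T58 T))"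
    by simp
  also have "\<dots> \<le> (\<Sum>f\<in>{1..5} \<rightarrow>\<^sub>E pverts T. \<Prod>e\<leftarrow>arcs58. 1 + orientation T (f (fst e)) (f (snd e)))"
    using sum_orientation_product_bounds(1)[OF tournament_T58 T]
    unfolding card_parcs_T58 unfolding verts set prod.distinct_set_conv_list[OF dist] .
  also have "\<dots> \<le> real n ^ 5 - real n / 32 * codegree_energy T"
    unfolding n_def codegree_energy_def codeg_def[symmetric] by (rule sum_arcs58_le)
  finally show ?thesis .
qed

lemma choose_asymptotic: "(\<lambda>n. fact k * real (n choose k) / real n ^ k) \<longlonglongrightarrow> 1"
proof -
  have "(\<lambda>n. \<Prod>i = 0..<k. (real n - real i) / real n) \<longlonglongrightarrow> (\<Prod>i = 0..<k. 1)"
  proof (rule tendsto_prod)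
    fix i
    have "(\<lambda>n. 1 - real i * inverse (real n)) \<longlonglongrightarrow> 1 - real i * 0"
      by (intro tendsto_intros lim_inverse_n)
    moreover have "\<forall>\<^sub>F n in sequentially. 1 - real i * inverse (real n) = (real n - real i) / real n"
      by (intro eventually_sequentiallyI[of 1]) (auto simp: field_simps)
    ultimately show "(\<lambda>n. (real n - real i) / real n) \<longlonglongrightarrow> 1"
      using Lim_transform_eventually by fastforce
  qed
  then show ?thesis
    by (simp add: binomial_gbinomial gbinomial_mult_fact prod_dividef)
qed

section \<open>Random tournaments and the limits\<close>

text \<open>\<open>B\<close> selects the pairs that are oriented upwards. Letting it range over all
  sets of increasing pairs replaces a uniformly random tournament by plain counting.\<close>

definition index_tournament :: "nat \<Rightarrow> (nat \<times> nat) set \<Rightarrow> nat pair_pre_digraph" where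
  "index_tournament n B = \<lparr>pverts = {..<n},
     parcs = {(i, j). i < n \<and> j < n \<and> (i < j \<and> (i, j) \<in> B \<or> j < i \<and> (j, i) \<notin> B)}\<rparr>"

lemma tournament_index_tournament: "tournament (index_tournament n B)"
proof unfold_locales
  show "finite (parcs (index_tournament n B))"
    by (rule finite_subset[of _ "{..<n} \<times> {..<n}"]) (auto simp: index_tournament_def)
qed (auto simp: index_tournament_def)

text \<open>A random subset of \<open>U\<close> has a prescribed trace on \<open>D\<close> with
  probability \<open>1 / 2 ^ card D\<close>, as its part outside \<open>D\<close> is free.\<close>

lemma card_Pow_trace:
  assumes "finite U" "D \<subseteq> U" "P \<subseteq> D"
  shows "2 ^ card D * card {B \<in> Pow U. B \<inter> D = P} = 2 ^ card U"
proof -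
  have "bij_betw (\<lambda>C. C \<union> P) (Pow (U - D)) {B \<in> Pow U. B \<inter> D = P}"
    by (rule bij_betw_byWitness[where f' = "\<lambda>B. B - D"]) (use assms in auto)
  then have "card {B \<in> Pow U. B \<inter> D = P} = 2 ^ (card U - card D)"
    using assms by (auto simp: bij_betw_same_card[symmetric] card_Pow card_Diff_subset finite_subset)
  then show ?thesis
    using card_mono[OF assms(1,2)] by (simp add: power_add[symmetric])
qed

text \<open>A fixed injection is an embedding with probability
  \<open>1 / 2 ^ card (parcs S)\<close>. Each arc decides the membership in \<open>B\<close> of the
  increasing pair \<open>h\<close> of its images, and these pairs are distinct; \<open>P\<close>
  contains those that must belong to \<open>B\<close>.\<close>

lemma card_index_tournaments_embedding:
  fixes S :: "'a pair_pre_digraph"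
  assumes S: "tournament S" and f: "f \<in> pverts S \<rightarrow>\<^sub>E {..<n}" "inj_on f (pverts S)"
  defines "U \<equiv> {(i, j). i < j \<and> j < n}"
  shows "2 ^ card (parcs S) * card {B \<in> Pow U. f \<in> embeddings S (index_tournament n B)} = 2 ^ card U"
proof -
  define h where "h = (\<lambda>e. if f (fst e) < f (snd e) then (f (fst e), f (snd e)) else (f (snd e), f (fst e)))"
  define D where "D = h ` parcs S"
  define P where "P = {(f u, f v) |u v. (u, v) \<in> parcs S \<and> f u < f v}"
  have neq: "f u \<noteq> f v" and less: "f u < n" "f v < n" if "(u, v) \<in> parcs S" for u v
    using that f tournament_arcD[OF S that] by (auto dest: inj_onD)
  have inj: "u = v" if "f u = f v" "u \<in> pverts S" "v \<in> pverts S" for u v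
    using f that by (auto dest: inj_onD)
  have "inj_on h (parcs S)"
  proof (rule inj_onI)
    fix d e assume "d \<in> parcs S" "e \<in> parcs S" "h d = h e"
    moreover obtain u v u' v' where "d = (u, v)" "e = (u', v')" by fastforce
    ultimately show "d = e"
      using inj tournament_arcD[OF S, of u v] tournament_arcD[OF S, of u' v']
      by (auto simp: h_def split: if_splits)
  qed
  then have cardD: "card D = card (parcs S)" by (simp add: D_def card_image)
  have DU: "D \<subseteq> U" using neq less by (force simp: D_def h_def U_def)
  have PD: "P \<subseteq> D" by (force simp: P_def D_def h_def)
  have finU: "finite U"
    by (rule finite_subset[of _ "{..<n} \<times> {..<n}"]) (auto simp: U_def)
  have "f \<in> embeddings S (index_tournament n B) \<longleftrightarrow> B \<inter> D = P" for B
  proof -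
    have "f \<in> embeddings S (index_tournament n B) \<longleftrightarrow>
      (\<forall>(u, v)\<in>parcs S. if f u < f v then (f u, f v) \<in> B else (f v, f u) \<notin> B)"
    proof -
      have "(f u, f v) \<in> parcs (index_tournament n B) \<longleftrightarrow>
        (if f u < f v then (f u, f v) \<in> B else (f v, f u) \<notin> B)" if "(u, v) \<in> parcs S" for u v
        using neq[OF that] less[OF that] by (auto simp: index_tournament_def)
      moreover have "f \<in> embeddings S (index_tournament n B) \<longleftrightarrow>
        (\<forall>(u, v)\<in>parcs S. (f u, f v) \<in> parcs (index_tournament n B))"
        using f by (simp add: embeddings_def index_tournament_def)
      ultimately show ?thesis by fast
    qed
    also have "\<dots> \<longleftrightarrow> B \<inter> D = P"
    proof
      assume *: "\<forall>(u, v)\<in>parcs S. if f u < f v then (f u, f v) \<in> B else (f v, f u) \<notin> B"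
      show "B \<inter> D = P"
      proof (intro equalityI subsetI)
        fix x assume "x \<in> B \<inter> D"
        then obtain u v where "(u, v) \<in> parcs S" "x = h (u, v)" "x \<in> B" by (auto simp: D_def)
        then show "x \<in> P" using * by (auto simp: P_def h_def split: if_splits)
      next
        fix x assume "x \<in> P"
        then show "x \<in> B \<inter> D" using * PD by (auto simp: P_def)
      qed
    next
      assume BD: "B \<inter> D = P"
      have "if f u < f v then (f u, f v) \<in> B else (f v, f u) \<notin> B" if uv: "(u, v) \<in> parcs S" for u v
      proof (cases "f u < f v")
        case True
        then have "(f u, f v) \<in> P" using uv by (auto simp: P_def)
        then show ?thesis using True BD by auto
      next
        case False
        then have "(f v, f u) \<in> D" using uv by (force simp: D_def h_def)
        moreover have "(f v, f u) \<notin> P"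
        proof
          assume "(f v, f u) \<in> P"
          then obtain u' v' where *: "f v = f u'" "f u = f v'" "(u', v') \<in> parcs S" by (auto simp: P_def)
          then have "v = u'" "u = v'" using inj tournament_arcD[OF S] uv by metis+
          then show False using * uv tournament_arcD(4)[OF S uv] by simp
        qed
        ultimately show ?thesis using False BD by auto
      qed
      then show "\<forall>(u, v)\<in>parcs S. if f u < f v then (f u, f v) \<in> B else (f v, f u) \<notin> B" by blast
    qed
    finally show ?thesis .
  qed
  then show ?thesis using card_Pow_trace[OF finU DU PD] cardD by simp
qed

text \<open>The average of the right-hand side over all tournaments on \<^term>\<open>{..<n}\<close> is the left-hand side.\<close>

lemma exists_tournament_many_embeddings:
  fixes S :: "'a pair_pre_digraph"
  assumes S: "tournament S"
  shows "\<exists>T :: nat pair_pre_digraph. tournament T \<and> card (pverts T) = n \<and>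
    fact (card (pverts S)) * (n choose card (pverts S)) \<le> 2 ^ card (parcs S) * card (embeddings S T)"
proof (rule ccontr)
  let ?U = "{(i, j). i < j \<and> j < n}" and ?J = "{f \<in> pverts S \<rightarrow>\<^sub>E {..<n}. inj_on f (pverts S)}"
  let ?e = "card (parcs S)" and ?T = "index_tournament n"
  assume "\<not> ?thesis"
  then have less: "2 ^ ?e * card (embeddings S (?T B)) < fact (card (pverts S)) * (n choose card (pverts S))" for B
    using tournament_index_tournament[of n B] by (auto simp: not_le index_tournament_def)
  have finU: "finite ?U"
    by (rule finite_subset[of _ "{..<n} \<times> {..<n}"]) auto
  have finJ: "finite ?J"
    using finite_PiE[of "pverts S" "\<lambda>_. {..<n}"] finite_pverts[OF S] by simp
  have emb: "embeddings S (?T B) = {f \<in> ?J. f \<in> embeddings S (?T B)}" for B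
    by (auto simp: embeddings_def index_tournament_def)
  have card_emb: "card (embeddings S (?T B)) = (\<Sum>f\<in>?J. of_bool (f \<in> embeddings S (?T B)))" for B
    using finJ by (subst emb) (simp add: sum.If_cases of_bool_def Int_def)
  have cardJ: "card ?J = fact (card (pverts S)) * (n choose card (pverts S))"
    using card_injections[OF finite_pverts[OF S], of "{..<n}"] by simp
  have "(\<Sum>B\<in>Pow ?U. 2 ^ ?e * card (embeddings S (?T B))) =
      (\<Sum>f\<in>?J. 2 ^ ?e * (\<Sum>B\<in>Pow ?U. of_bool (f \<in> embeddings S (?T B))))"
    unfolding card_emb sum_distrib_left by (rule sum.swap)
  also have "\<dots> = (\<Sum>f\<in>?J. 2 ^ ?e * card {B \<in> Pow ?U. f \<in> embeddings S (?T B)})"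
    using finU by (intro sum.cong refl) (simp add: sum.If_cases of_bool_def Int_def)
  also have "\<dots> = (\<Sum>f\<in>?J. 2 ^ card ?U)"
    using card_index_tournaments_embedding[OF S] by (intro sum.cong refl) auto
  also have "\<dots> = (\<Sum>B\<in>Pow ?U. card ?J)"
    using finU by (simp add: card_Pow)
  finally have "(\<Sum>B\<in>Pow ?U. 2 ^ ?e * card (embeddings S (?T B))) = (\<Sum>B\<in>Pow ?U. card ?J)" .
  moreover have "(\<Sum>B\<in>Pow ?U. 2 ^ ?e * card (embeddings S (?T B))) < (\<Sum>B\<in>Pow ?U. card ?J)"
    using finU less unfolding cardJ by (intro sum_strict_mono) auto
  ultimately show False by simp
qed

lemma exists_tournament_density_T58:
  assumes "n \<ge> 5"
  shows "\<exists>T :: nat pair_pre_digraph. tournament T \<and> card (pverts T) = n \<and> 15 / 128 \<le> density T58 T"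
proof -
  obtain T :: "nat pair_pre_digraph" where T: "tournament T" "card (pverts T) = n"
    and "fact (card (pverts T58)) * (n choose card (pverts T58)) \<le> 2 ^ card (parcs T58) * card (embeddings T58 T)"
    using exists_tournament_many_embeddings[OF tournament_T58] by blast
  then have "120 * (n choose 5) \<le> 1024 * card (embeddings T58 T)"
    by (simp add: card_pverts_T58 card_parcs_T58 fact_numeral)
  then have "120 * real (n choose 5) \<le> 1024 * real (card (embeddings T58 T))"
    by (metis of_nat_le_iff of_nat_mult of_nat_numeral)
  moreover have "n choose 5 > 0" using assms by simp
  ultimately have "15 / 128 \<le> density T58 T"
    using T unfolding density_eq_embeddings[OF tournament_T58 T(1)]
    by (simp add: Aut_T58 card_pverts_T58 field_simps)
  then show ?thesis using T by blast
qed

lemma density_T58_upper: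
  assumes T: "tournament T" and n: "card (pverts T) = n" "n \<ge> 5"
  shows "density T58 T \<le> 15 / 128 * inverse (fact 5 * real (n choose 5) / real n ^ 5)"
proof -
  have "real n / 32 * codegree_energy T \<ge> 0" by (simp add: codegree_energy_nonneg)
  then have "1024 * (density T58 T * real (n choose 5)) \<le> real n ^ 5"
    using density_T58_le[OF T] unfolding n(1) by linarith
  moreover have "real (n choose 5) > 0" using n by simp
  ultimately show ?thesis by (simp add: field_simps fact_numeral)
qed

lemma Max_density_T58:
  "(\<lambda>n. Max {density T58 T | T :: nat pair_pre_digraph. tournament T \<and> card (pverts T) = n}) \<longlonglongrightarrow> 15 / 128"
  (is "(\<lambda>n. Max (?D n)) \<longlonglongrightarrow> _")
proof (rule tendsto_sandwich[where f = "\<lambda>_. 15 / 128"])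
  \<comment> \<open>\<open>Max\<close> needs a finite set. There are infinitely many tournaments on
    \<open>n\<close> natural numbers, but their densities share a denominator and have numerators at
    most \<open>2 ^ n\<close>.\<close>
  have fin: "finite (?D n)" for n
  proof (rule finite_subset)
    show "?D n \<subseteq> (\<lambda>m. real m / real (n choose 5)) ` {..2 ^ n}"
    proof clarify
      fix T :: "nat pair_pre_digraph" assume T: "tournament T" "n = card (pverts T)"
      let ?X = "{S. S \<subseteq> pverts T \<and> card S = card (pverts T58) \<and>
        digraph_iso (with_proj T \<restriction> S) (with_proj T58)}"
      have "card ?X \<le> card (Pow (pverts T))"
        using finite_pverts[OF T(1)] by (intro card_mono) auto
      then have "card ?X \<le> 2 ^ card (pverts T)" using finite_pverts[OF T(1)] by (simp add: card_Pow)
      then show "density T58 T \<in> (\<lambda>m. real m / real (card (pverts T) choose 5)) ` {..2 ^ card (pverts T)}"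
        unfolding density_def card_pverts_T58 by (intro image_eqI[of _ _ "card ?X"]) (auto simp: card_pverts_T58)
    qed
  qed auto
  show "\<forall>\<^sub>F n in sequentially. 15 / 128 \<le> Max (?D n)"
  proof (rule eventually_sequentiallyI[of 5])
    fix n :: nat assume "5 \<le> n"
    then obtain T :: "nat pair_pre_digraph" where T: "tournament T" "card (pverts T) = n" "15 / 128 \<le> density T58 T"
      using exists_tournament_density_T58 by blast
    then have "density T58 T \<le> Max (?D n)" using fin by (intro Max_ge) auto
    then show "15 / 128 \<le> Max (?D n)" using T(3) by simp
  qed
  show "\<forall>\<^sub>F n in sequentially. Max (?D n) \<le> 15 / 128 * inverse (fact 5 * real (n choose 5) / real n ^ 5)"
  proof (rule eventually_sequentiallyI[of 5])
    fix n :: nat assume n: "5 \<le> n"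
    then have "?D n \<noteq> {}" using exists_tournament_density_T58 by blast
    then show "Max (?D n) \<le> 15 / 128 * inverse (fact 5 * real (n choose 5) / real n ^ 5)"
      using fin density_T58_upper[OF _ _ n] by (subst Max_le_iff) auto
  qed
  have "(\<lambda>n. 15 / 128 * inverse (fact 5 * real (n choose 5) / real n ^ 5)) \<longlonglongrightarrow> 15 / 128 * inverse 1"
    by (intro tendsto_intros choose_asymptotic) simp
  then show "(\<lambda>n. 15 / 128 * inverse (fact 5 * real (n choose 5) / real n ^ 5)) \<longlonglongrightarrow> 15 / 128" by simp
qed auto

section \<open>The two implications between density and energy\<close>

text \<open>The normalized count \<open>x\<close> tends to 1, with two errors: the fourth root of
  the normalized energy for the nonempty patterns, and \<open>1 - c\<close> for the non-injective
  maps.\<close>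

lemma tendsto_phi_qr:
  fixes Ts :: "nat \<Rightarrow> 'b pair_pre_digraph" and S :: "'a pair_pre_digraph"
  assumes Ts: "\<And>n. tournament (Ts n)" and size: "filterlim (\<lambda>n. card (pverts (Ts n))) at_top sequentially"
    and energy: "(\<lambda>n. codegree_energy (Ts n) / real (card (pverts (Ts n))) ^ 4) \<longlonglongrightarrow> 0"
    and S: "tournament S"
  shows "(\<lambda>n. density S (Ts n)) \<longlonglongrightarrow> phi_qr S"
proof -
  define N where "N = (\<lambda>n. card (pverts (Ts n)))"
  define k where "k = card (pverts S)"
  define e where "e = card (parcs S)"
  define c where "c = (\<lambda>n. fact k * real (N n choose k) / real (N n) ^ k)"
  define x where "x = (\<lambda>n. 2 ^ e * real (card (embeddings S (Ts n))) / real (N n) ^ k)"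
  have c: "c \<longlonglongrightarrow> 1"
    unfolding c_def N_def by (rule filterlim_compose[OF choose_asymptotic size])
  have pos: "\<forall>\<^sub>F n in sequentially. N n > 0"
    using filterlim_at_top[THEN iffD1, rule_format, OF size, of 1] by (simp add: N_def Suc_le_eq)
  have "x \<longlonglongrightarrow> 1"
  \<comment> \<open>The empty tournament is separate because \<open>k - 1\<close> is truncated, so
    \<open>?n ^ k\<close> does not split off a factor.\<close>
  proof (cases "k = 0")
    case True
    then have verts: "pverts S = {}" using finite_pverts[OF S] by (simp add: k_def)
    then have arcs: "parcs S = {}" using tournament_arcD[OF S] by fastforce
    have "embeddings S (Ts n) = {\<lambda>_. undefined}" for n
      by (simp add: embeddings_def verts arcs)
    then have "x = (\<lambda>_. 1)" using True by (simp add: x_def e_def arcs)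
    then show ?thesis by simp
  next
    case False
    have "(\<lambda>n. x n - 1) \<longlonglongrightarrow> 0"
    proof (rule tendsto_rabs_zero_cancel, rule tendsto_sandwich[where f = "\<lambda>_. 0"])
      show "\<forall>\<^sub>F n in sequentially. \<bar>x n - 1\<bar> \<le>
        2 ^ e * root 4 (codegree_energy (Ts n) / real (N n) ^ 4) + 2 ^ e * (1 - c n)"
        using pos
      proof eventually_elim
        case (elim n)
        let ?n = "real (N n)"
        have npos: "?n > 0" using elim by simp
        have power: "?n ^ k = ?n ^ (k - 1) * ?n"
          using False by (metis Suc_pred' neq0_conv power_Suc2)
        have "root 4 (codegree_energy (Ts n) / ?n ^ 4) = root 4 (codegree_energy (Ts n)) / ?n"
          using npos by (simp add: real_root_divide real_root_power_cancel)
        moreover have "\<bar>x n - 1\<bar> = \<bar>2 ^ e * real (card (embeddings S (Ts n))) - ?n ^ k\<bar> / ?n ^ k"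
        proof -
          have "x n - 1 = (2 ^ e * real (card (embeddings S (Ts n))) - ?n ^ k) / ?n ^ k"
            using npos by (simp add: x_def diff_divide_distrib)
          then show ?thesis using npos by (simp only: abs_divide power_abs abs_of_pos)
        qed
        moreover have "\<dots> \<le> (2 ^ e * (?n ^ (k - 1) * root 4 (codegree_energy (Ts n))) +
            2 ^ e * (?n ^ k - fact k * real (N n choose k))) / ?n ^ k"
          using embeddings_approx[OF S Ts[of n]] npos unfolding e_def k_def N_def
          by (intro divide_right_mono) auto
        moreover have "\<dots> = 2 ^ e * (root 4 (codegree_energy (Ts n)) / ?n) + 2 ^ e * (1 - c n)"
          using npos unfolding c_def power by (simp add: field_simps)
        ultimately show ?case by simp
      qed
      have "(\<lambda>n. 2 ^ e * root 4 (codegree_energy (Ts n) / real (N n) ^ 4) + 2 ^ e * (1 - c n)) \<longlonglongrightarrow>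
        2 ^ e * root 4 0 + 2 ^ e * (1 - 1)"
        using energy unfolding N_def by (intro tendsto_intros c)
      then show "(\<lambda>n. 2 ^ e * root 4 (codegree_energy (Ts n) / real (N n) ^ 4) + 2 ^ e * (1 - c n)) \<longlonglongrightarrow> 0"
        by simp
    qed auto
    then show ?thesis by (simp add: LIM_zero_iff)
  qed
  then have "(\<lambda>n. x n / c n * (fact k / (real (card (Aut S)) * 2 ^ e))) \<longlonglongrightarrow>
      1 / 1 * (fact k / (real (card (Aut S)) * 2 ^ e))"
    by (intro tendsto_intros c) auto
  \<comment> \<open>When \<open>N n < k\<close>, the divisions by zero make both sides 0.\<close>
  moreover have "\<forall>\<^sub>F n in sequentially. x n / c n * (fact k / (real (card (Aut S)) * 2 ^ e)) = density S (Ts n)"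
    using pos
  proof eventually_elim
    case (elim n)
    then show ?case
      unfolding density_eq_embeddings[OF S Ts] x_def c_def N_def k_def by simp
  qed
  ultimately have "(\<lambda>n. density S (Ts n)) \<longlonglongrightarrow> 1 / 1 * (fact k / (real (card (Aut S)) * 2 ^ e))"
    by (rule Lim_transform_eventually)
  then show ?thesis by (simp add: phi_qr_def k_def e_def card_parcs[OF S])
qed

lemma codegree_energy_tendsto_0:
  assumes Ts: "\<And>n. tournament (Ts n)" and size: "filterlim (\<lambda>n. card (pverts (Ts n))) at_top sequentially"
    and lim: "(\<lambda>n. density T58 (Ts n)) \<longlonglongrightarrow> 15 / 128"
  shows "(\<lambda>n. codegree_energy (Ts n) / real (card (pverts (Ts n))) ^ 4) \<longlonglongrightarrow> 0"
proof -
  define N where "N = (\<lambda>n. card (pverts (Ts n)))"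
  define c where "c = (\<lambda>n. fact 5 * real (N n choose 5) / real (N n) ^ 5)"
  have c: "c \<longlonglongrightarrow> 1"
    unfolding c_def N_def by (rule filterlim_compose[OF choose_asymptotic size])
  have pos: "\<forall>\<^sub>F n in sequentially. N n > 0"
    using filterlim_at_top[THEN iffD1, rule_format, OF size, of 1] by (simp add: N_def Suc_le_eq)
  show ?thesis
  proof (rule tendsto_sandwich[where f = "\<lambda>_. 0"])
    show "\<forall>\<^sub>F n in sequentially. codegree_energy (Ts n) / real (card (pverts (Ts n))) ^ 4 \<le>
      32 * (1 - 128 / 15 * density T58 (Ts n) * c n)"
      using pos
    proof eventually_elim
      case (elim n)
      let ?n = "real (N n)" and ?E = "codegree_energy (Ts n)" and ?d = "density T58 (Ts n)"
      have npos: "?n > 0" using elim by simp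
      have "1024 * (?d * real (N n choose 5)) \<le> ?n ^ 5 - ?n / 32 * ?E"
        unfolding N_def by (rule density_T58_le[OF Ts])
      then have "1024 * (?d * real (N n choose 5)) / ?n ^ 5 \<le> (?n ^ 5 - ?n / 32 * ?E) / ?n ^ 5"
        using npos by (intro divide_right_mono) auto
      \<comment> \<open>The factor is \<open>1024 / 5!\<close>, the inverse of the limit
        density.\<close>
      moreover have "1024 * (?d * real (N n choose 5)) / ?n ^ 5 = 128 / 15 * ?d * c n"
        by (simp add: c_def fact_numeral)
      moreover have "(?n ^ 5 - ?n / 32 * ?E) / ?n ^ 5 = 1 - ?E / ?n ^ 4 / 32"
        using npos by (simp add: field_simps eval_nat_numeral)
      ultimately have "128 / 15 * ?d * c n \<le> 1 - ?E / ?n ^ 4 / 32" by (simp only:)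
      moreover have "y \<le> 32 * (1 - a)" if "a \<le> 1 - y / 32" for a y :: real
        using that by simp
      ultimately have "?E / ?n ^ 4 \<le> 32 * (1 - 128 / 15 * ?d * c n)" by blast
      then show ?case by (simp only: N_def)
    qed
    have "(\<lambda>n. 32 * (1 - 128 / 15 * density T58 (Ts n) * c n)) \<longlonglongrightarrow> 32 * (1 - 128 / 15 * (15 / 128) * 1)"
      by (intro tendsto_intros lim c)
    then show "(\<lambda>n. 32 * (1 - 128 / 15 * density T58 (Ts n) * c n)) \<longlonglongrightarrow> 0" by simp
  qed (auto simp: codegree_energy_nonneg)
qed

theorem theorem1p1:
  shows "((\<lambda>n. Max {density T58 T | T :: nat pair_pre_digraph.
                     tournament T \<and> card (pverts T) = n}) \<longlonglongrightarrow> 15 / 128) \<and>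
         (\<forall>Ts :: nat \<Rightarrow> 'a pair_pre_digraph.
            (\<forall>n. tournament (Ts n)) \<and> (\<forall>n. card (pverts (Ts n)) < card (pverts (Ts (Suc n)))) \<longrightarrow>
            ((\<lambda>n. density T58 (Ts n)) \<longlonglongrightarrow> 15 / 128 \<longleftrightarrow> quasi_random Ts))"
proof (intro conjI allI impI)
  fix Ts :: "nat \<Rightarrow> 'a pair_pre_digraph"
  assume "(\<forall>n. tournament (Ts n)) \<and> (\<forall>n. card (pverts (Ts n)) < card (pverts (Ts (Suc n))))"
  then have Ts: "\<And>n. tournament (Ts n)" and size: "filterlim (\<lambda>n. card (pverts (Ts n))) at_top sequentially"
    by (auto intro!: filterlim_subseq simp: strict_mono_Suc_iff)
  show "(\<lambda>n. density T58 (Ts n)) \<longlonglongrightarrow> 15 / 128 \<longleftrightarrow> quasi_random Ts"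
  proof
    assume "(\<lambda>n. density T58 (Ts n)) \<longlonglongrightarrow> 15 / 128"
    then show "quasi_random Ts"
      unfolding quasi_random_def
      using tendsto_phi_qr[OF Ts size codegree_energy_tendsto_0[OF Ts size]] by blast
  next
    assume "quasi_random Ts"
    then have "(\<lambda>n. density T58 (Ts n)) \<longlonglongrightarrow> phi_qr T58"
      unfolding quasi_random_def using tournament_T58 by blast
    then show "(\<lambda>n. density T58 (Ts n)) \<longlonglongrightarrow> 15 / 128"
      by (simp only: phi_qr_T58)
  qed
qed (rule Max_density_T58)

end
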